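(* Let $\mathcal{U}\subset\mathbb{H}(\mathbb{C})^{\tilde g}$ be an nc open set and let $F:\mathbb{H}(\mathbb{C})^{\tilde g}\times\mathbb{H}(\mathbb{C})^g\to\mathbb{H}(\mathbb{C})$ be a matrix-valued nc function in the noncommuting tuples $a=(a_1,\dots,a_{\tilde g})$ and $x=(x_1,\dots,x_g)$. Suppose that for each $A\in\mathcal{U}$, $F$ is both matrix convex in $x$ at $(C_A,0)$ and $x$-real entire at $(C_A,0)$. Then $F$ is a matrix-valued nc polynomial of degree $2$ or less in $X$ (that is, in the variables $x$).
   Context: **NC polynomials.** For noncommuting variables $z=(z_1,\dots,z_r)$, $\mathbb{C}\langle z\rangle$ denotes the ring of noncommutative (nc) polynomials, i.e. finite linear combinations $p=\sum_w p_w z^w$ of words with $p_w\in\mathbb{C}$. The involution $*$ on $\mathbb{C}\langle z\rangle$ is determined by $z_i^*=z_i$, $(pq)^*=q^*p^*$, $(\lambda p)^*=\overline{\lambda}p^*$. A matrix-valued nc polynomial is a matrix $P=(p_{ij})$ with entries in $\mathbb{C}\langle z\rangle$; it is Hermitian if $P^*=P$, where $(P^* )_{ij}=p_{ji}^*$. Polynomials are evaluated at tuples $Z$ of $n\times n$ Hermitian matrices by substituting $Z_i$ for $z_i$, and matrix-valued polynomials are evaluated entrywise. **NC sets and functions.** $\mathbb{H}(\mathbb{C}^{n\times n})^r$ is the set of $r$-tuples of $n\times n$ Hermitian matrices, and $\mathbb{H}(\mathbb{C})^r=\bigcup_{n\ge1}\mathbb{H}(\mathbb{C}^{n\times n})^r$.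 An nc set is a subset $D\subset\mathbb{H}(\mathbb{C})^r$ closed under direct sums ($Z,\tilde Z\in D\Rightarrow Z\oplus\tilde Z\in D$, taken coordinatewise) and under unitary equivalence (if $Z\in D$ has size $n$ and $U$ is an $n\times n$ unitary, then $U^*ZU=(U^*Z_1U,\dots,U^*Z_rU)\in D$). It is nc open if it is open in every matrix size $n$. An nc function $f$ on an nc set $D$ assigns to each $Z\in D$ of size $n$ an $n\times n$ complex matrix $f(Z)$, with $f(Z\oplus\tilde Z)=f(Z)\oplus f(\tilde Z)$ for $Z,\tilde Z\in D$ and $f(U^*ZU)=U^*f(Z)U$ for $Z\in D$ of size $n$ and $U$ an $n\times n$ unitary. A matrix-valued nc function is a matrix $F=(F_{ij})$ whose entries are nc functions. For functions of two tuples $(a,x)$ one takes $z=(a,x)$ and $r=\tilde g+g$, so in a pair $(A,X)$ all matrices have the same size. The norm of $X\in\mathbb{H}(\mathbb{C}^{n\times n})^g$ is $\|X\|=$ the maximum eigenvalue of $(\sum_i X_iX_i^* )^{1/2}$. **The set $C_A$.** For $A\in\mathbb{H}(\mathbb{C}^{\kappa\times\kappa})^{\tilde g}$, $C_A=\bigcup_{m\ge1}\{U^*(I_m\otimes A)U: U \text{ a unitary matrix of size }\kappa m\}$ is the smallest nc set containing $A$; $(C_A,0)=\{(\alpha,0):\alpha\in C_A\}$. **$x$-power series, Hermitian.** A formal $x$-power series is a sum $\sum_{i}F_i(a,x)$ where each $F_i$ is a matrix-valued nc polynomial in $(a,x)$ homogeneous of degree $i$ in $x$. A matrix-valued nc function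 $F$ with a power series $F(a,x)=\sum_iF_i(a,x)$ that converges absolutely and uniformly on some nc set is called Hermitian if each $F_i$ is a Hermitian matrix-valued polynomial. **$x$-real entire at $(C_A,0)$.** For $A\in\mathbb{H}(\mathbb{C}^{\kappa\times\kappa})^{\tilde g}$, an nc function $F$ is $x$-real entire at $(C_A,0)$ if: (1) there exist $\varepsilon>0$ and an $x$-power series $\sum_iF_i(a,x)$ such that for each $\alpha=U^*(I_m\otimes A)U\in C_A$ the expansion $F(\alpha,X)=\sum_iF_i(\alpha,X)$ converges on the open $x$-ball $\{(\alpha,X):X\in\mathbb{H}(\mathbb{C}^{\kappa m\times\kappa m})^g,\ \|X\|<\varepsilon\}$; and (2) the matrix-valued analytic function $F$ in the $x$-ball near $(\alpha,0)$ analytically continues, as a function of $g(\kappa m)^2$ complex variables, to an open set in $(\mathbb{C}^{\kappa m\times\kappa m})^g$ containing $\mathbb{H}(\mathbb{C}^{\kappa m\times\kappa m})^g$. A matrix-valued nc function is $x$-real entire at $(C_A,0)$ if each of its entries is. **Matrix convex in $x$ at $(C_A,0)$.** For $A\in\mathbb{H}(\mathbb{C}^{\kappa\times\kappa})^{\tilde g}$, $F$ is matrix convex in $x$ at $(C_A,0)$ if $F$ is Hermitian and there is a uniform $\varepsilon>0$ such that for every $m$, every $\alpha=U^*(I_m\otimes A)U\in C_A$ of size $\kappa m$, all $X,Y\in\mathbb{H}(\mathbb{C}^{\kappa m\times\kappa m})^g$ with $\|X\|,\|Y\|<\varepsilon$, and all $t\in[0,1]$, $$F(\alpha,tX+(1-t)Y)\preceq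 tF(\alpha,X)+(1-t)F(\alpha,Y),$$ where $\preceq$ is the Loewner (positive semidefinite) order.
   Formalization: One and the same x-power series of F is assumed at all (C_A,0), A in U (otherwise exp(a_1) is a counterexample); the analytic continuation must agree with F at all Hermitian X; and F is shown to equal the polynomial only for A in U, as F is unconstrained off U. *)

theory Defs
  imports
    "Jordan_Normal_Form.Schur_Decomposition"
    "HOL-Library.Poly_Mapping"
begin

(* The variables of an nc tuple are indexed by a finite type 'v, so a tuple of matrices is a
   function 'v => complex mat; the number r of variables is CARD('v).  For a pair (a,x) of
   tuples, 'v is a sum type 'a + 'x and the pair (A,X) is the tuple case_sum A X. *)

type_synonym 'v tuple = "'v \<Rightarrow> complex mat"

section \<open>Matrices\<close>

definition herm :: "nat \<Rightarrow> complex mat \<Rightarrow> bool" where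
  "herm n M \<longleftrightarrow> M \<in> carrier_mat n n \<and> mat_adjoint M = M"

definition unitary :: "nat \<Rightarrow> complex mat \<Rightarrow> bool" where
  "unitary n U \<longleftrightarrow>
     U \<in> carrier_mat n n \<and> mat_adjoint U * U = 1\<^sub>m n \<and> U * mat_adjoint U = 1\<^sub>m n"

(* 0 \<le> z for a complex number z means that z is real and nonnegative. *)
definition psd :: "nat \<Rightarrow> complex mat \<Rightarrow> bool" where
  "psd n M \<longleftrightarrow> herm n M \<and> (\<forall>v \<in> carrier_vec n. 0 \<le> (M *\<^sub>v v) \<bullet>c v)"

definition loewner_le :: "nat \<Rightarrow> complex mat \<Rightarrow> complex mat \<Rightarrow> bool" where
  "loewner_le n M N \<longleftrightarrow> psd n (N - M)"

(* The positive semidefinite square root; for positive semidefinite M the choice is unique. *)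
definition mat_sqrt :: "nat \<Rightarrow> complex mat \<Rightarrow> complex mat" where
  "mat_sqrt n M = (SOME R. psd n R \<and> R * R = M)"

definition max_eigenvalue :: "complex mat \<Rightarrow> real" where
  "max_eigenvalue M = Max {l :: real. eigenvalue M (complex_of_real l)}"

section \<open>Tuples of matrices\<close>

definition tuples :: "nat \<Rightarrow> 'v tuple set" where
  "tuples n = {Z. \<forall>v. Z v \<in> carrier_mat n n}"

definition herm_tuples :: "nat \<Rightarrow> 'v tuple set" where
  "herm_tuples n = {Z. \<forall>v. herm n (Z v)}"

definition all_herm_tuples :: "'v tuple set" where
  "all_herm_tuples = (\<Union>n \<in> {1..}. herm_tuples n)"

definition tuple_norm :: "nat \<Rightarrow> ('v :: finite) tuple \<Rightarrow> real" where
  "tuple_norm n X = max_eigenvalue (mat_sqrt n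
     (mat n n (\<lambda>(k, l). \<Sum>v\<in>UNIV. (X v * mat_adjoint (X v)) $$ (k, l))))"

(* The operator norm of a single matrix, that is, its norm as a tuple of length one. *)
definition op_norm :: "nat \<Rightarrow> complex mat \<Rightarrow> real" where
  "op_norm n M = tuple_norm n (\<lambda>_ :: unit. M)"

definition dsum :: "complex mat \<Rightarrow> complex mat \<Rightarrow> complex mat" where
  "dsum M N = diag_block_mat [M, N]"

definition tuple_dsum :: "'v tuple \<Rightarrow> 'v tuple \<Rightarrow> 'v tuple" where
  "tuple_dsum Z W = (\<lambda>v. dsum (Z v) (W v))"

definition tuple_conj :: "complex mat \<Rightarrow> 'v tuple \<Rightarrow> 'v tuple" where
  "tuple_conj U Z = (\<lambda>v. mat_adjoint U * Z v * U)"

definition tuple_ampl :: "nat \<Rightarrow> 'v tuple \<Rightarrow> 'v tuple" where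
  "tuple_ampl m A = (\<lambda>v. diag_block_mat (replicate m (A v)))"

section \<open>Noncommutative polynomials\<close>

(* Only the vector space structure of the polynomial mappings is used: p represents the sum of
   (lookup p w) z^w over the words w in keys p. *)
type_synonym 'v ncpoly = "'v list \<Rightarrow>\<^sub>0 complex"

definition eval_word :: "nat \<Rightarrow> 'v tuple \<Rightarrow> 'v list \<Rightarrow> complex mat" where
  "eval_word n Z w = foldr (\<lambda>v M. Z v * M) w (1\<^sub>m n)"

definition eval_ncpoly :: "nat \<Rightarrow> 'v ncpoly \<Rightarrow> 'v tuple \<Rightarrow> complex mat" where
  "eval_ncpoly n p Z =
     mat n n (\<lambda>(k, l). \<Sum>w\<in>Poly_Mapping.keys p.
       Poly_Mapping.lookup p w * eval_word n Z w $$ (k, l))"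

definition ncpoly_star :: "'v ncpoly \<Rightarrow> 'v ncpoly" where
  "ncpoly_star p = (\<Sum>w\<in>Poly_Mapping.keys p.
     Poly_Mapping.single (rev w) (cnj (Poly_Mapping.lookup p w)))"

definition x_degree :: "('a + 'x) list \<Rightarrow> nat" where
  "x_degree w = length (filter (\<lambda>v. \<not> isl v) w)"

definition x_homogeneous :: "nat \<Rightarrow> ('a + 'x) ncpoly \<Rightarrow> bool" where
  "x_homogeneous k p \<longleftrightarrow> (\<forall>w \<in> Poly_Mapping.keys p. x_degree w = k)"

definition x_degree_le :: "nat \<Rightarrow> ('a + 'x) ncpoly \<Rightarrow> bool" where
  "x_degree_le k p \<longleftrightarrow> (\<forall>w \<in> Poly_Mapping.keys p. x_degree w \<le> k)"

section \<open>Matrix-valued polynomials, functions and power series\<close>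

(* A d x d matrix with entries in a type 'e is a function of two indices, used below d only. *)
type_synonym 'e matrix_of = "nat \<Rightarrow> nat \<Rightarrow> 'e"

definition block_mat :: "nat \<Rightarrow> nat \<Rightarrow> complex mat matrix_of \<Rightarrow> complex mat" where
  "block_mat d n B =
     mat (d * n) (d * n) (\<lambda>(k, l). B (k div n) (l div n) $$ (k mod n, l mod n))"

definition herm_ncpoly_matrix :: "nat \<Rightarrow> 'v ncpoly matrix_of \<Rightarrow> bool" where
  "herm_ncpoly_matrix d P \<longleftrightarrow> (\<forall>i<d. \<forall>j<d. ncpoly_star (P j i) = P i j)"

definition eval_fun_matrix ::
  "nat \<Rightarrow> nat \<Rightarrow> ('v tuple \<Rightarrow> complex mat) matrix_of \<Rightarrow> 'v tuple \<Rightarrow> complex mat" where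
  "eval_fun_matrix d n F Z = block_mat d n (\<lambda>i j. F i j Z)"

definition eval_ncpoly_matrix ::
  "nat \<Rightarrow> nat \<Rightarrow> 'v ncpoly matrix_of \<Rightarrow> 'v tuple \<Rightarrow> complex mat" where
  "eval_ncpoly_matrix d n P Z = block_mat d n (\<lambda>i j. eval_ncpoly n (P i j) Z)"

(* The k-th member of the sequence is the part of degree k in x. *)
definition x_power_series :: "nat \<Rightarrow> (nat \<Rightarrow> ('a + 'x) ncpoly matrix_of) \<Rightarrow> bool" where
  "x_power_series d S \<longleftrightarrow> (\<forall>k. \<forall>i<d. \<forall>j<d. x_homogeneous k (S k i j))"

section \<open>Noncommutative sets and functions\<close>

definition nc_set :: "'v tuple set \<Rightarrow> bool" where
  "nc_set D \<longleftrightarrow>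
     D \<subseteq> all_herm_tuples \<and>
     (\<forall>Z \<in> D. \<forall>W \<in> D. tuple_dsum Z W \<in> D) \<and>
     (\<forall>n. \<forall>Z \<in> D \<inter> herm_tuples n. \<forall>U. unitary n U \<longrightarrow> tuple_conj U Z \<in> D)"

definition nc_open :: "('v :: finite) tuple set \<Rightarrow> bool" where
  "nc_open D \<longleftrightarrow>
     (\<forall>n\<ge>1. \<forall>Z \<in> D \<inter> herm_tuples n. \<exists>\<epsilon>>0. \<forall>W \<in> herm_tuples n.
        tuple_norm n (\<lambda>v. W v - Z v) < \<epsilon> \<longrightarrow> W \<in> D)"

definition nc_function :: "'v tuple set \<Rightarrow> ('v tuple \<Rightarrow> complex mat) \<Rightarrow> bool" where
  "nc_function D f \<longleftrightarrow>
     (\<forall>n. \<forall>Z \<in> D \<inter> herm_tuples n. f Z \<in> carrier_mat n n) \<and>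
     (\<forall>Z \<in> D. \<forall>W \<in> D. f (tuple_dsum Z W) = dsum (f Z) (f W)) \<and>
     (\<forall>n. \<forall>Z \<in> D \<inter> herm_tuples n. \<forall>U. unitary n U \<longrightarrow>
        f (tuple_conj U Z) = mat_adjoint U * f Z * U)"

(* The part of C_A in size k * m, for A of size k. *)
definition C_level :: "nat \<Rightarrow> 'v tuple \<Rightarrow> nat \<Rightarrow> 'v tuple set" where
  "C_level k A m = {tuple_conj U (tuple_ampl m A) | U. unitary (k * m) U}"

section \<open>Hermitian nc functions and matrix convexity in x\<close>

definition converges_abs_unif ::
  "nat \<Rightarrow> (('v :: finite) tuple \<Rightarrow> complex mat) matrix_of \<Rightarrow> (nat \<Rightarrow> 'v ncpoly matrix_of)
     \<Rightarrow> 'v tuple set \<Rightarrow> bool" where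
  "converges_abs_unif d F S D \<longleftrightarrow>
     (\<forall>n\<ge>1. \<forall>Z \<in> D \<inter> herm_tuples n.
        summable (\<lambda>k. op_norm (d * n) (eval_ncpoly_matrix d n (S k) Z))) \<and>
     (\<forall>e>0. \<exists>K0. \<forall>K\<ge>K0. \<forall>n\<ge>1. \<forall>Z \<in> D \<inter> herm_tuples n.
        op_norm (d * n) (block_mat d n
          (\<lambda>i j. F i j Z - eval_ncpoly n (\<Sum>k<K. S k i j) Z)) < e)"

(* The power series S of F is a parameter here and below: one and the same x-power series of F
   is meant at all the sets (C_A,0).  The empty set is excluded as a region of convergence. *)
definition hermitian_nc ::
  "nat \<Rightarrow> (('a :: finite + 'x :: finite) tuple \<Rightarrow> complex mat) matrix_of
     \<Rightarrow> (nat \<Rightarrow> ('a + 'x) ncpoly matrix_of) \<Rightarrow> bool" where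
  "hermitian_nc d F S \<longleftrightarrow>
     x_power_series d S \<and>
     (\<exists>D. D \<noteq> {} \<and> nc_set D \<and> converges_abs_unif d F S D) \<and>
     (\<forall>k. herm_ncpoly_matrix d (S k))"

definition matrix_convex_in_x_at ::
  "nat \<Rightarrow> (('a :: finite + 'x :: finite) tuple \<Rightarrow> complex mat) matrix_of
     \<Rightarrow> (nat \<Rightarrow> ('a + 'x) ncpoly matrix_of) \<Rightarrow> nat \<Rightarrow> 'a tuple \<Rightarrow> bool" where
  "matrix_convex_in_x_at d F S \<kappa> A \<longleftrightarrow>
     hermitian_nc d F S \<and>
     (\<exists>\<epsilon>>0. \<forall>m\<ge>1. \<forall>\<alpha> \<in> C_level \<kappa> A m.
        \<forall>X \<in> herm_tuples (\<kappa> * m). \<forall>Y \<in> herm_tuples (\<kappa> * m). \<forall>t \<in> {0..1 :: real}.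
          tuple_norm (\<kappa> * m) X < \<epsilon> \<longrightarrow> tuple_norm (\<kappa> * m) Y < \<epsilon> \<longrightarrow>
          loewner_le (d * (\<kappa> * m))
            (eval_fun_matrix d (\<kappa> * m) F (case_sum \<alpha>
               (\<lambda>v. complex_of_real t \<cdot>\<^sub>m X v + complex_of_real (1 - t) \<cdot>\<^sub>m Y v)))
            (complex_of_real t \<cdot>\<^sub>m eval_fun_matrix d (\<kappa> * m) F (case_sum \<alpha> X)
             + complex_of_real (1 - t) \<cdot>\<^sub>m eval_fun_matrix d (\<kappa> * m) F (case_sum \<alpha> Y)))"

section \<open>x-real entire functions\<close>

definition open_tuples :: "nat \<Rightarrow> ('v :: finite) tuple set \<Rightarrow> bool" where
  "open_tuples n W \<longleftrightarrow>
     W \<subseteq> tuples n \<and>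
     (\<forall>X \<in> W. \<exists>\<delta>>0. \<forall>Y \<in> tuples n. tuple_norm n (\<lambda>v. Y v - X v) < \<delta> \<longrightarrow> Y \<in> W)"

(* A function of the CARD('v) * n^2 complex matrix entries is analytic on the open set W if it
   is complex differentiable at every point of W: c v k l is the partial derivative with
   respect to the (k,l) entry of the matrix with index v. *)
definition analytic_on_tuples ::
  "nat \<Rightarrow> ('v :: finite) tuple set \<Rightarrow> ('v tuple \<Rightarrow> complex) \<Rightarrow> bool" where
  "analytic_on_tuples n W f \<longleftrightarrow>
     (\<forall>X \<in> W. \<exists>c :: 'v \<Rightarrow> nat \<Rightarrow> nat \<Rightarrow> complex. \<forall>e>0. \<exists>\<delta>>0. \<forall>H \<in> tuples n.
        tuple_norm n H < \<delta> \<longrightarrow>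
        cmod (f (\<lambda>v. X v + H v) - f X - (\<Sum>v\<in>UNIV. \<Sum>k<n. \<Sum>l<n. c v k l * H v $$ (k, l)))
          \<le> e * tuple_norm n H)"

(* Expansion of a single entry of a matrix-valued function, with series p.  As f is defined on
   all Hermitian tuples, its analytic continuation is required to agree with f there. *)
definition entry_x_real_entire_at ::
  "(('a :: finite + 'x :: finite) tuple \<Rightarrow> complex mat) \<Rightarrow> (nat \<Rightarrow> ('a + 'x) ncpoly)
     \<Rightarrow> nat \<Rightarrow> 'a tuple \<Rightarrow> bool" where
  "entry_x_real_entire_at f p \<kappa> A \<longleftrightarrow>
     (\<exists>\<epsilon>>0. \<forall>m\<ge>1. \<forall>\<alpha> \<in> C_level \<kappa> A m.
        \<forall>X \<in> herm_tuples (\<kappa> * m). tuple_norm (\<kappa> * m) X < \<epsilon> \<longrightarrow>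
          (\<forall>k < \<kappa> * m. \<forall>l < \<kappa> * m.
             (\<lambda>i. eval_ncpoly (\<kappa> * m) (p i) (case_sum \<alpha> X) $$ (k, l))
               sums (f (case_sum \<alpha> X) $$ (k, l)))) \<and>
     (\<forall>m\<ge>1. \<forall>\<alpha> \<in> C_level \<kappa> A m. \<exists>W G.
        open_tuples (\<kappa> * m) W \<and> herm_tuples (\<kappa> * m) \<subseteq> W \<and>
        (\<forall>k < \<kappa> * m. \<forall>l < \<kappa> * m. analytic_on_tuples (\<kappa> * m) W (\<lambda>X. G X $$ (k, l))) \<and>
        (\<forall>X \<in> herm_tuples (\<kappa> * m). G X = f (case_sum \<alpha> X)))"

definition x_real_entire_at ::
  "nat \<Rightarrow> (('a :: finite + 'x :: finite) tuple \<Rightarrow> complex mat) matrix_of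
     \<Rightarrow> (nat \<Rightarrow> ('a + 'x) ncpoly matrix_of) \<Rightarrow> nat \<Rightarrow> 'a tuple \<Rightarrow> bool" where
  "x_real_entire_at d F S \<kappa> A \<longleftrightarrow>
     x_power_series d S \<and>
     (\<forall>i<d. \<forall>j<d. entry_x_real_entire_at (F i j) (\<lambda>k. S k i j) \<kappa> A)"

end

theory Submission
  imports
    "HOL-Complex_Analysis.Complex_Analysis"
    "Jordan_Normal_Form.Spectral_Radius"
    Defs
begin

text \<open>
  Only one-variable functions need to be understood. Fix A in U and a Hermitian tuple H of the same
  size. For a real symmetric m x m matrix T, the tuple X = T \<otimes> H satisfies
  S_p(I \<otimes> A, X) = T^p \<otimes> S_p(A, H). Hence, with c_p = w^* S_p(A, H) w, convexity at (C_A, 0) says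
  that the power series \<Sum> c_p T^p is matrix convex near 0, tested against the first basis vector.

  Take for T the weighted path 0, ..., N bordered by one further vertex, which is joined to the vertex n
  with weight \<xi>_n \<delta>^(N+1-n); the edges of the path have weight \<delta>. Changing the sign of \<xi> and averaging
  removes the border, so convexity compares closed walks at 0 with and without the border. To leading
  order in \<delta> the difference is \<Sum> c_(i+j+2) \<xi>_i \<xi>_j. Hence this Hankel form is nonnegative.

  If c_4 were positive, log-convexity of c_2, c_4, c_6, ... would give the even part of the series a finite
  radius of convergence and nonnegative coefficients. By Pringsheim's theorem it would be singular on the
  real axis, contradicting real entireness. Therefore c_4 = 0, and the Hankel inequalities
  give c_p = 0 for all p \<ge> 3. Thus F agrees with S_0 + S_1 + S_2 near X = 0, and along
  every real line by analytic continuation.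
\<close>

unbundle no vec_syntax
unbundle no inner_syntax

section \<open>Square roots of positive semidefinite matrices\<close>

text \<open>Convexity is known only near 0, where low coefficients swamp high ones; the edge weights
  are built to defeat this. Climbing the path to n costs \<open>\<delta>^n\<close> and the border
  edge at n costs \<open>\<delta>^(N+1-n)\<close>, so the border vertex is reached at cost
  \<open>\<delta>^(N+1)\<close> whatever n is. Closed walks that meet the border have order at least
  \<open>\<delta>^(2N+2)\<close>, and the leading term comes from those that climb straight to i,
  cross the border vertex to j and descend straight. Such a walk has length i + j + 2 and weight
  \<open>\<xi> i * \<xi> j\<close> at that order, so coefficients of all degrees from 2 to 2N + 2
  enter at one order and survive division by it. The shift by 2 is where the degree bound comes
  from: c_0 and c_1 lie outside the Hankel form, c_2 is its corner and may stay positive, and c_3^2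
  \<le> c_2 c_4 removes c_3. As N is arbitrary, the radius of convexity has to be uniform in the
  number m of copies of A. Because \<open>tuple_norm\<close> is built from a chosen square root and
  a \<open>Max\<close>, even the smallness of a tuple requires some spectral theory.\<close>

lemma dim_mat_adjoint [simp]:
  "dim_row (mat_adjoint M) = dim_col M" "dim_col (mat_adjoint M) = dim_row M"
  by (simp_all add: mat_adjoint_def)

lemma index_mat_adjoint [simp]:
  "i < dim_col M \<Longrightarrow> j < dim_row M \<Longrightarrow> mat_adjoint M $$ (i, j) = conjugate (M $$ (j, i))"
  by (simp add: mat_adjoint_def mat_of_rows_def)

lemma mat_adjoint_carrier [simp]:
  "M \<in> carrier_mat m n \<Longrightarrow> mat_adjoint M \<in> carrier_mat n m"
  by (intro carrier_matI) simp_all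

lemma mat_adjoint_adjoint [simp]: "mat_adjoint (mat_adjoint M) = M"
  by (rule eq_matI) auto

lemma mat_adjoint_one [simp]: "mat_adjoint (1\<^sub>m n :: complex mat) = 1\<^sub>m n"
  by (rule eq_matI) auto

lemma mat_adjoint_mult:
  fixes M N :: "complex mat"
  assumes "M \<in> carrier_mat m n" "N \<in> carrier_mat n l"
  shows "mat_adjoint (M * N) = mat_adjoint N * mat_adjoint M"
  using assms by (intro eq_matI) (auto simp: scalar_prod_def intro!: sum.cong)

lemma mult_mat_adjoint_cscalar:
  fixes M :: "complex mat"
  assumes "M \<in> carrier_mat m n" "v \<in> carrier_vec n" "w \<in> carrier_vec m"
  shows "(M *\<^sub>v v) \<bullet>c w = v \<bullet>c (mat_adjoint M *\<^sub>v w)"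
proof -
  have "(M *\<^sub>v v) \<bullet>c w = (\<Sum>i<m. \<Sum>j<n. M $$ (i,j) * v $ j * cnj (w $ i))"
    using assms by (auto simp: scalar_prod_def sum_distrib_right lessThan_atLeast0 intro!: sum.cong)
  also have "\<dots> = (\<Sum>j<n. \<Sum>i<m. M $$ (i,j) * v $ j * cnj (w $ i))"
    by (rule sum.swap)
  also have "\<dots> = v \<bullet>c (mat_adjoint M *\<^sub>v w)"
    using assms by (auto simp: scalar_prod_def sum_distrib_left lessThan_atLeast0 mult_ac
        intro!: sum.cong)
  finally show ?thesis .
qed

lemma mult_square_mat_carrier [simp]:
  "M \<in> carrier_mat n n \<Longrightarrow> N \<in> carrier_mat n n \<Longrightarrow> M * N \<in> carrier_mat n n"
  by (rule mult_carrier_mat)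

lemma mult_one_square_mat [simp]:
  fixes M :: "'a :: semiring_1 mat"
  assumes "M \<in> carrier_mat n n"
  shows "M * 1\<^sub>m n = M" "1\<^sub>m n * M = M"
  using right_mult_one_mat[OF assms] left_mult_one_mat[OF assms] by simp_all

lemma assoc_mult_square_mat:
  fixes M :: "'a :: semiring_0 mat"
  assumes "M \<in> carrier_mat n n" "N \<in> carrier_mat n n" "P \<in> carrier_mat n n"
  shows "M * N * P = M * (N * P)"
  using assms by (rule assoc_mult_mat)

lemma unitary_one: "unitary n (1\<^sub>m n)"
  by (simp add: unitary_def)

lemma unitaryI:
  assumes "U \<in> carrier_mat n n" "mat_adjoint U * U = 1\<^sub>m n"
  shows "unitary n U"
  unfolding unitary_def
  by (intro conjI assms mat_mult_left_right_inverse[OF mat_adjoint_carrier[OF assms(1)] assms])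

lemma unitary_mult:
  assumes U: "unitary n U" and V: "unitary n V"
  shows "unitary n (U * V)"
proof (rule unitaryI)
  have [simp]: "U \<in> carrier_mat n n" "V \<in> carrier_mat n n"
    using assms by (simp_all add: unitary_def)
  show "U * V \<in> carrier_mat n n" by simp
  have "mat_adjoint (U * V) * (U * V) = mat_adjoint V * (mat_adjoint U * U) * V"
    by (simp add: mat_adjoint_mult[of U n n V n] assoc_mult_square_mat[where n = n])
  then show "mat_adjoint (U * V) * (U * V) = 1\<^sub>m n"
    using assms by (simp add: unitary_def)
qed

lemma psd_mult_adjoint:
  assumes "C \<in> carrier_mat n m"
  shows "psd n (C * mat_adjoint C)"
  unfolding psd_def herm_def
proof (intro conjI ballI)
  show "C * mat_adjoint C \<in> carrier_mat n n" using assms by auto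
  show "mat_adjoint (C * mat_adjoint C) = C * mat_adjoint C"
    using assms by (simp add: mat_adjoint_mult[of C n m _ n])
  fix v :: "complex vec" assume v: "v \<in> carrier_vec n"
  let ?w = "mat_adjoint C *\<^sub>v v"
  have w: "?w \<in> carrier_vec m"
    using assms v by (intro mult_mat_vec_carrier[of _ m n]) simp_all
  have "(C * mat_adjoint C *\<^sub>v v) \<bullet>c v = (C *\<^sub>v ?w) \<bullet>c v"
    using assms v by (subst assoc_mult_mat_vec[of _ n m _ n]) auto
  also have "\<dots> = ?w \<bullet>c ?w"
    using assms v w by (subst mult_mat_adjoint_cscalar[of _ n m]) auto
  also have "\<dots> \<ge> 0"
    by (rule conjugate_square_ge_0_vec)
  finally show "0 \<le> (C * mat_adjoint C *\<^sub>v v) \<bullet>c v" .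
qed

text \<open>One deflation step: an eigenvector is completed to an orthonormal basis, whose members
  are the columns of \<open>W\<close>.\<close>

lemma eigenvector_unitary_exists:
  fixes M :: "complex mat"
  assumes M: "M \<in> carrier_mat n n" and "n > 0"
  obtains W e where "unitary n W"
    "\<forall>i<n. (mat_adjoint W * M * W) $$ (i, 0) = (if i = 0 then e else 0)"
proof -
  from spectrum_non_empty[OF M] \<open>n > 0\<close> obtain e where "eigenvalue M e"
    by (auto simp: spectrum_def)
  then obtain v where v: "v \<in> carrier_vec n" "v \<noteq> 0\<^sub>v n" "M *\<^sub>v v = e \<cdot>\<^sub>v v"
    using M by (auto simp: eigenvalue_def eigenvector_def)
  interpret cof_vec_space n "TYPE(complex)" .
  define b where "b = basis_completion v"
  define ws where "ws = gram_schmidt n b"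
  from basis_completion[OF v(1,2), folded b_def]
  have b: "distinct b" "\<not> lin_dep (set b)" "set b \<subseteq> carrier_vec n" "hd b = v" "length b = n"
    by auto
  then obtain vs where bv: "b = v # vs" using \<open>n > 0\<close> by (cases b) auto
  from gram_schmidt_result[OF b(3,1,2) refl, folded ws_def]
  have ws: "set ws \<subseteq> carrier_vec n" "corthogonal ws" "length ws = n" by (auto simp: b)
  have "hd ws = v"
    using gram_schmidt_hd[OF v(1), of vs, folded bv] by (simp add: ws_def)
  then have ws0: "ws ! 0 = v"
    using ws(3) \<open>n > 0\<close> by (metis hd_conv_nth list.size(3) not_less0)
  have wsc: "ws ! j \<in> carrier_vec n" if "j < n" for j using ws that by auto
  \<comment> \<open>\<open>gram_schmidt\<close> keeps the head v and makes the list orthogonal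
    without normalizing it; \<open>nu\<close> holds the lengths.\<close>
  define nu where "nu j = sqrt (Re (ws ! j \<bullet>c ws ! j))" for j
  have nu: "ws ! j \<bullet>c ws ! j = complex_of_real (nu j ^ 2)" "nu j > 0" if "j < n" for j
  proof -
    have "ws ! j \<bullet>c ws ! j \<noteq> 0" using corthogonalD[OF ws(2), of j j] that ws(3) by auto
    moreover have "ws ! j \<bullet>c ws ! j \<ge> 0" by (rule conjugate_square_ge_0_vec)
    ultimately have *: "Re (ws ! j \<bullet>c ws ! j) > 0" "Im (ws ! j \<bullet>c ws ! j) = 0"
      by (auto simp: less_eq_complex_def complex_eq_iff)
    then show "nu j > 0" by (simp add: nu_def)
    show "ws ! j \<bullet>c ws ! j = complex_of_real (nu j ^ 2)"
      using * by (simp add: nu_def complex_eq_iff)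
  qed
  define W where "W = mat n n (\<lambda>(i, j). ws ! j $ i / complex_of_real (nu j))"
  have W: "W \<in> carrier_mat n n" by (simp add: W_def)
  have colW: "col W j = (1 / complex_of_real (nu j)) \<cdot>\<^sub>v ws ! j" if "j < n" for j
    using wsc[OF that] that by (intro eq_vecI) (auto simp: W_def)
  have ortho: "ws ! j \<bullet>c ws ! i = (if i = j then complex_of_real (nu i ^ 2) else 0)"
    if "i < n" "j < n" for i j
    using corthogonalD[OF ws(2), of j i] nu(1)[OF that(1)] that ws(3) by auto
  have adjprod: "(mat_adjoint W *\<^sub>v x) $ i = (x \<bullet>c ws ! i) / complex_of_real (nu i)"
    if "i < n" "x \<in> carrier_vec n" for i x
    using that wsc[OF that(1)] W
    by (auto simp: W_def scalar_prod_def sum_divide_distrib mult_ac intro!: sum.cong)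
  have "mat_adjoint W * W = 1\<^sub>m n"
  proof (rule eq_matI)
    fix i j assume "i < dim_row (1\<^sub>m n :: complex mat)" "j < dim_col (1\<^sub>m n :: complex mat)"
    then have ij: "i < n" "j < n" by auto
    have "(mat_adjoint W * W) $$ (i, j) = (mat_adjoint W *\<^sub>v col W j) $ i"
      using ij W by simp
    also have "\<dots> = (ws ! j \<bullet>c ws ! i) / complex_of_real (nu i) / complex_of_real (nu j)"
      using ij wsc by (subst adjprod) (auto simp: colW smult_scalar_prod_distrib[of _ n])
    also have "\<dots> = 1\<^sub>m n $$ (i, j)"
      using ij nu(2)[OF ij(1)] by (subst ortho) (auto simp: power2_eq_square)
    finally show "(mat_adjoint W * W) $$ (i, j) = 1\<^sub>m n $$ (i, j)" .
  qed (use W in auto)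
  with W have uW: "unitary n W" by (rule unitaryI)
  have "(mat_adjoint W * M * W) $$ (i, 0) = (if i = 0 then e else 0)" if i: "i < n" for i
  proof -
    have "(mat_adjoint W * M * W) $$ (i, 0) = (mat_adjoint W * (M * W)) $$ (i, 0)"
      using W M by (subst assoc_mult_square_mat[where n = n]) auto
    also have "\<dots> = (mat_adjoint W *\<^sub>v (M *\<^sub>v col W 0)) $ i"
      using W M i \<open>n > 0\<close> by (simp add: mult_mat_vec_def)
    also have "M *\<^sub>v col W 0 = (e / complex_of_real (nu 0)) \<cdot>\<^sub>v v"
      using \<open>n > 0\<close> M v by (simp add: colW ws0 mult_mat_vec smult_smult_assoc)
    also have "(mat_adjoint W *\<^sub>v \<dots>) $ i =
        e * (ws ! 0 \<bullet>c ws ! i) / complex_of_real (nu 0) / complex_of_real (nu i)"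
      using i v wsc[OF i] by (subst adjprod) (auto simp: ws0)
    also have "\<dots> = (if i = 0 then e else 0)"
      using i \<open>n > 0\<close> nu(2)[of 0] by (subst ortho) (auto simp: power2_eq_square)
    finally show ?thesis .
  qed
  with uW show thesis by (intro that[of W e]) auto
qed

text \<open>Induction by deflation. Conjugation by \<open>W\<close> clears the first column below
  the corner; the result is again Hermitian, so its first row is cleared too and the remaining block
  is Hermitian of size n.\<close>

lemma herm_diagonalizable:
  assumes "herm n M"
  obtains V D where "unitary n V" "D \<in> carrier_mat n n" "diagonal_mat D"
    "M = V * D * mat_adjoint V"
  using assms
proof (induction n arbitrary: M thesis)
  case 0
  then show ?case
    by (intro 0(1)[of "1\<^sub>m 0" "M"]) (auto simp: unitary_one diagonal_mat_def herm_def)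
next
  case (Suc n)
  have M: "M \<in> carrier_mat (Suc n) (Suc n)" "mat_adjoint M = M"
    using Suc.prems(2) by (auto simp: herm_def)
  obtain W e where W: "unitary (Suc n) W"
    and col0: "\<forall>i<Suc n. (mat_adjoint W * M * W) $$ (i, 0) = (if i = 0 then e else 0)"
    by (rule eigenvector_unitary_exists[OF M(1) zero_less_Suc])
  have Wc: "W \<in> carrier_mat (Suc n) (Suc n)" using W by (simp add: unitary_def)
  define M' where "M' = mat_adjoint W * M * W"
  have M'c: "M' \<in> carrier_mat (Suc n) (Suc n)" using Wc M by (auto simp: M'_def)
  have adjM': "mat_adjoint M' = M'"
    using Wc M by (simp add: M'_def mat_adjoint_mult[of _ "Suc n" "Suc n" _ "Suc n"]
        assoc_mult_square_mat[where n = "Suc n"])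
  have M'h: "M' $$ (i, j) = conjugate (M' $$ (j, i))" if "i < Suc n" "j < Suc n" for i j
    using that M'c index_mat_adjoint[of i M' j] adjM' by simp
  define M3 where "M3 = mat n n (\<lambda>(i, j). M' $$ (Suc i, Suc j))"
  have M3c: "M3 \<in> carrier_mat n n" by (simp add: M3_def)
  have "herm n M3"
    unfolding herm_def
  proof (intro conjI eq_matI M3c)
    fix i j assume "i < dim_row M3" "j < dim_col M3"
    then show "mat_adjoint M3 $$ (i, j) = M3 $$ (i, j)"
      using M'h[of "Suc i" "Suc j"] by (simp add: M3_def)
  qed (simp_all add: M3_def)
  then obtain V3 D3 where V3: "unitary n V3" and D3: "D3 \<in> carrier_mat n n" "diagonal_mat D3"
    and M3: "M3 = V3 * D3 * mat_adjoint V3"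
    using Suc.IH by blast
  have V3c: "V3 \<in> carrier_mat n n" using V3 by (simp add: unitary_def)
  let ?E = "mat 1 1 (\<lambda>_. e)"
  define V' where "V' = four_block_mat (1\<^sub>m 1) (0\<^sub>m 1 n) (0\<^sub>m n 1) V3"
  define D' where "D' = four_block_mat ?E (0\<^sub>m 1 n) (0\<^sub>m n 1) D3"
  have V'c: "V' \<in> carrier_mat (Suc n) (Suc n)"
    using four_block_carrier_mat[of "1\<^sub>m 1" 1 1 V3 n n] V3c by (simp add: V'_def)
  have D'c: "D' \<in> carrier_mat (Suc n) (Suc n)"
    using four_block_carrier_mat[of "?E" 1 1 D3 n n] D3 by (simp add: D'_def)
  have adjV': "mat_adjoint V' = four_block_mat (1\<^sub>m 1) (0\<^sub>m 1 n) (0\<^sub>m n 1) (mat_adjoint V3)"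
    using V3c by (intro eq_matI) (auto simp: V'_def)
  have "mat_adjoint V' * V' = four_block_mat (1\<^sub>m 1) (0\<^sub>m 1 n) (0\<^sub>m n 1) (mat_adjoint V3 * V3)"
    unfolding adjV' unfolding V'_def using V3c
    by (subst mult_four_block_mat[of _ 1 1 _ n _ n _ _ 1 _ n]) auto
  also have "\<dots> = 1\<^sub>m (Suc n)"
    using V3 by (intro eq_matI) (auto simp: unitary_def)
  finally have V': "unitary (Suc n) V'" using V'c by (intro unitaryI)
  have M'0: "M' = four_block_mat ?E (0\<^sub>m 1 n) (0\<^sub>m n 1) M3"
  proof (rule eq_matI)
    fix i j assume "i < dim_row (four_block_mat ?E (0\<^sub>m 1 n) (0\<^sub>m n 1) M3)"
      "j < dim_col (four_block_mat ?E (0\<^sub>m 1 n) (0\<^sub>m n 1) M3)"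
    then have ij: "i < Suc n" "j < Suc n" by (auto simp: M3_def)
    show "M' $$ (i, j) = four_block_mat ?E (0\<^sub>m 1 n) (0\<^sub>m n 1) M3 $$ (i, j)"
      using ij col0[folded M'_def] M'h[of 0 j]
      by (auto simp: M3_def)
  qed (use M'c M3c in auto)
  have "V' * D' = four_block_mat ?E (0\<^sub>m 1 n) (0\<^sub>m n 1) (V3 * D3)"
    unfolding V'_def D'_def using V3c D3
    by (subst mult_four_block_mat[of _ 1 1 _ n _ n _ _ 1 _ n]) auto
  also have "\<dots> * mat_adjoint V' = four_block_mat ?E (0\<^sub>m 1 n) (0\<^sub>m n 1) (V3 * D3 * mat_adjoint V3)"
    unfolding adjV' using V3c D3
    by (subst mult_four_block_mat[of _ 1 1 _ n _ n _ _ 1 _ n]) auto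
  finally have M'D: "M' = V' * D' * mat_adjoint V'" by (simp add: M'0 M3)
  have "M = W * mat_adjoint W * M * (W * mat_adjoint W)"
    using W M by (simp add: unitary_def)
  also have "\<dots> = W * M' * mat_adjoint W"
    using Wc M by (simp add: M'_def assoc_mult_square_mat[where n = "Suc n"])
  also have "\<dots> = (W * V') * D' * mat_adjoint (W * V')"
    using Wc V'c D'c
    by (simp add: M'D mat_adjoint_mult[of _ "Suc n" "Suc n" _ "Suc n"]
        assoc_mult_square_mat[where n = "Suc n"])
  finally have "M = (W * V') * D' * mat_adjoint (W * V')" .
  moreover have "diagonal_mat D'"
    using D3 by (auto simp: diagonal_mat_def D'_def)
  ultimately show ?case
    using Suc.prems(1) unitary_mult[OF W V'] D'c by blast
qed

text \<open>\<open>mat_sqrt\<close> is a \<open>SOME\<close>, so nothing follows about it until a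
  root is exhibited.\<close>

lemma psd_sqrt_exists:
  assumes "psd n M"
  obtains R where "psd n R" "R * R = M"
proof -
  have "herm n M" using assms by (simp add: psd_def)
  then obtain V D where V: "unitary n V" and D: "D \<in> carrier_mat n n" "diagonal_mat D"
    and M: "M = V * D * mat_adjoint V"
    by (rule herm_diagonalizable)
  have Vc: "V \<in> carrier_mat n n" and VV: "mat_adjoint V * V = 1\<^sub>m n"
    using V by (simp_all add: unitary_def)
  have D_nonneg: "0 \<le> D $$ (i, i)" if i: "i < n" for i
  proof -
    let ?v = "V *\<^sub>v unit_vec n i"
    have "mat_adjoint V *\<^sub>v ?v = unit_vec n i"
      using Vc VV by (simp flip: assoc_mult_mat_vec[of _ n n _ n])
    then have "M *\<^sub>v ?v = V *\<^sub>v (D *\<^sub>v unit_vec n i)"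
      using Vc D by (simp add: M assoc_mult_mat_vec[of _ n n _ n])
    then have "(M *\<^sub>v ?v) \<bullet>c ?v = (D *\<^sub>v unit_vec n i) \<bullet>c (mat_adjoint V *\<^sub>v ?v)"
      using Vc D by (simp add: mult_mat_adjoint_cscalar[of _ n n])
    also have "\<dots> = (D *\<^sub>v unit_vec n i) \<bullet>c unit_vec n i"
      using \<open>mat_adjoint V *\<^sub>v ?v = _\<close> by simp
    also have "\<dots> = D $$ (i, i)"
      using D i by (simp add: scalar_prod_def unit_vec_def if_distrib[of cnj] sum.delta
          if_distrib[where f = "\<lambda>x. _ * x"] cong: if_cong)
    finally show ?thesis
      using assms mult_mat_vec_carrier[OF Vc, of "unit_vec n i"] unfolding psd_def
      by (metis unit_vec_carrier)
  qed
  \<comment> \<open>Fourth roots, not square roots: \<open>R\<close> then has the form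
    \<open>C * mat_adjoint C\<close> with \<open>C = V * E\<close>, hence is positive semidefinite,
    and \<open>R * R\<close> contains the fourth power of \<open>E\<close>.\<close>
  define f where "f = (\<lambda>i. complex_of_real (sqrt (sqrt (Re (D $$ (i, i))))))"
  have f4: "f i * f i * (f i * f i) = D $$ (i, i)" if "i < n" for i
  proof -
    have "0 \<le> Re (D $$ (i, i))" "Im (D $$ (i, i)) = 0"
      using D_nonneg[OF that] by (auto simp: less_eq_complex_def)
    then show ?thesis
      by (simp add: f_def complex_eq_iff flip: of_real_mult)
  qed
  define E where "E = mat n n (\<lambda>(i, j). if i = j then f i else 0)"
  have E: "E \<in> carrier_mat n n" by (simp add: E_def)
  have adjE: "mat_adjoint E = E" by (rule eq_matI) (auto simp: E_def f_def)
  have EE: "E * E = mat n n (\<lambda>(i, j). if i = j then f i * f i else 0)"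
    by (rule eq_matI) (auto simp: E_def scalar_prod_def sum.delta if_distrib[of "\<lambda>x. _ * x"]
        if_distrib[of "\<lambda>x. x * _"] cong: if_cong)
  have EEEE: "E * E * (E * E) = D"
    unfolding EE using D
    by (intro eq_matI) (auto simp: f4[symmetric] diagonal_mat_def scalar_prod_def sum.delta
        if_distrib[of "\<lambda>x. _ * x"] if_distrib[of "\<lambda>x. x * _"] cong: if_cong)
  define R where "R = (V * E) * mat_adjoint (V * E)"
  have R: "R = V * (E * E) * mat_adjoint V"
    using Vc E by (simp add: R_def adjE mat_adjoint_mult[of _ n n _ n] assoc_mult_square_mat[where n = n])
  have "R * R = V * (E * E) * (mat_adjoint V * V) * (E * E) * mat_adjoint V"
    using Vc E by (simp add: R assoc_mult_square_mat[where n = n])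
  also have "\<dots> = V * (E * E * (E * E)) * mat_adjoint V"
    unfolding VV using Vc E by (simp add: assoc_mult_square_mat[where n = n])
  finally have "R * R = M" by (simp add: EEEE M)
  moreover have "psd n R"
    unfolding R_def using Vc E by (intro psd_mult_adjoint[of _ n n]) auto
  ultimately show thesis using that by blast
qed

section \<open>Entrywise bounds for eigenvalues and for the norm of a tuple\<close>

lemma eigenvalue_modulus_le:
  fixes M :: "complex mat"
  assumes M: "M \<in> carrier_mat n n" and v: "v \<in> carrier_vec n" "v \<noteq> 0\<^sub>v n" "M *\<^sub>v v = e \<cdot>\<^sub>v v"
    and B: "\<And>k l. k < n \<Longrightarrow> l < n \<Longrightarrow> cmod (M $$ (k, l)) \<le> B"
  shows "cmod e \<le> real n * B"
proof -
  let ?S = "(\<lambda>k. cmod (v $ k)) ` {..<n}"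
  have "n > 0" using v by (cases n) auto
  \<comment> \<open>The eigenvalue equation is read at a coordinate of v of largest modulus.\<close>
  then have "Max ?S \<in> ?S" by (intro Max_in) auto
  then obtain k where k: "k < n" "Max ?S = cmod (v $ k)" by auto
  have kmax: "cmod (v $ l) \<le> cmod (v $ k)" if "l < n" for l
    using that by (simp flip: k(2))
  have "v $ k \<noteq> 0"
  proof
    assume "v $ k = 0"
    then have "v = 0\<^sub>v n" using kmax v(1) by (intro eq_vecI) auto
    with v(2) show False by contradiction
  qed
  have "e * v $ k = (M *\<^sub>v v) $ k" using v(1) k by (simp add: v(3))
  also have "\<dots> = (\<Sum>l<n. M $$ (k, l) * v $ l)"
    using M v(1) k by (simp add: scalar_prod_def lessThan_atLeast0)
  finally have "cmod e * cmod (v $ k) = cmod (\<Sum>l<n. M $$ (k, l) * v $ l)"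
    by (simp flip: norm_mult)
  also have "\<dots> \<le> (\<Sum>l<n. B * cmod (v $ k))"
    using B[OF k(1)] kmax
    by (intro sum_norm_le) (auto simp: norm_mult intro!: mult_mono intro: order_trans[OF norm_ge_zero])
  also have "\<dots> = real n * B * cmod (v $ k)" by simp
  finally show ?thesis using \<open>v $ k \<noteq> 0\<close> by simp
qed

text \<open>An eigenvalue l of a root \<open>R\<close> yields the eigenvalue l^2 of M, which the
  entries of M bound. Since \<open>max_eigenvalue\<close> is a \<open>Max\<close>, the set of real
  eigenvalues must also be shown finite and nonempty; positive semidefiniteness of \<open>R\<close>
  makes its eigenvalues real.\<close>

lemma max_eigenvalue_sqrt_le:
  assumes M: "psd n M" and n: "n \<ge> 1"
    and B: "\<And>k l. k < n \<Longrightarrow> l < n \<Longrightarrow> cmod (M $$ (k, l)) \<le> B"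
  shows "max_eigenvalue (mat_sqrt n M) \<le> sqrt (real n * B)"
proof -
  define R where "R = mat_sqrt n M"
  obtain R0 where "psd n R0 \<and> R0 * R0 = M"
    using psd_sqrt_exists[OF M] by blast
  then have R: "psd n R" "R * R = M"
    unfolding R_def mat_sqrt_def by (rule someI[where P = "\<lambda>R. psd n R \<and> R * R = M", THEN conjunct1],
        rule someI[where P = "\<lambda>R. psd n R \<and> R * R = M", THEN conjunct2])
  have Rc: "R \<in> carrier_mat n n" using R by (simp add: psd_def herm_def)
  define E where "E = {l :: real. eigenvalue R (complex_of_real l)}"
  have "finite {z. poly (char_poly R) z = 0}"
    using degree_monic_char_poly[OF Rc] by (intro poly_roots_finite) auto
  then have "finite E"
    unfolding E_def eigenvalue_root_char_poly[OF Rc]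
    using finite_vimageI[of _ complex_of_real] by (fastforce simp: vimage_def inj_def)
  moreover have "E \<noteq> {}"
  proof -
    obtain e where "eigenvalue R e"
      using spectrum_non_empty[OF Rc] n by (auto simp: spectrum_def)
    then obtain v where v: "v \<in> carrier_vec n" "v \<noteq> 0\<^sub>v n" "R *\<^sub>v v = e \<cdot>\<^sub>v v"
      using Rc by (auto simp: eigenvalue_def eigenvector_def)
    have "0 \<le> (R *\<^sub>v v) \<bullet>c v" using R(1) v(1) by (auto simp: psd_def)
    also have "(R *\<^sub>v v) \<bullet>c v = e * (v \<bullet>c v)"
      using v by (simp add: smult_scalar_prod_distrib[of _ n])
    finally have "0 \<le> e * (v \<bullet>c v)" .
    moreover have "v \<bullet>c v > 0"
      using conjugate_square_greater_0_vec[OF v(1)] v(2) by simp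
    ultimately have "Im e = 0"
      by (auto simp: less_eq_complex_def less_complex_def)
    then have "e = complex_of_real (Re e)" by (simp add: complex_eq_iff)
    with \<open>eigenvalue R e\<close> have "Re e \<in> E" by (simp add: E_def)
    then show ?thesis by auto
  qed
  moreover have "l \<le> sqrt (real n * B)" if "l \<in> E" for l
  proof -
    obtain v where v: "v \<in> carrier_vec n" "v \<noteq> 0\<^sub>v n" "R *\<^sub>v v = complex_of_real l \<cdot>\<^sub>v v"
      using Rc \<open>l \<in> E\<close> by (auto simp: E_def eigenvalue_def eigenvector_def)
    have Mc: "M \<in> carrier_mat n n" using M by (simp add: psd_def herm_def)
    have "M *\<^sub>v v = R *\<^sub>v (R *\<^sub>v v)"
      using Rc v by (simp flip: R(2) add: assoc_mult_mat_vec[of _ n n _ n])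
    also have "\<dots> = complex_of_real (l ^ 2) \<cdot>\<^sub>v v"
      using Rc v by (simp add: mult_mat_vec[of _ n n] smult_smult_assoc power2_eq_square)
    finally have "cmod (complex_of_real (l ^ 2)) \<le> real n * B"
      using eigenvalue_modulus_le[OF Mc v(1,2)] B by blast
    then have "l ^ 2 \<le> real n * B" by (simp add: norm_power)
    then show ?thesis by (rule real_le_rsqrt)
  qed
  ultimately show ?thesis
    unfolding max_eigenvalue_def R_def[symmetric] E_def[symmetric] by (subst Max_le_iff) auto
qed

lemma psd_sum_mult_adjoint:
  fixes X :: "('v :: finite) tuple"
  assumes X: "X \<in> tuples n"
  shows "psd n (mat n n (\<lambda>(k, l). \<Sum>v\<in>UNIV. (X v * mat_adjoint (X v)) $$ (k, l)))"
    (is "psd n ?M")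
  unfolding psd_def herm_def
proof (intro conjI ballI)
  let ?P = "\<lambda>v. X v * mat_adjoint (X v)"
  have Xc: "X v \<in> carrier_mat n n" for v using X by (simp add: tuples_def)
  have P: "psd n (?P v)" for v using psd_mult_adjoint[OF Xc] .
  have Pc: "?P v \<in> carrier_mat n n" for v using P by (simp add: psd_def herm_def)
  have cP: "cnj (?P v $$ (l, k)) = ?P v $$ (k, l)" if "k < n" "l < n" for v k l
  proof -
    have "mat_adjoint (?P v) = ?P v" using P[of v] by (simp add: psd_def herm_def)
    then show ?thesis
      using index_mat_adjoint[of k "?P v" l] Pc[of v] that
      by (metis carrier_matD conjugate_complex_def)
  qed
  show "?M \<in> carrier_mat n n" by simp
  show "mat_adjoint ?M = ?M"
    by (rule eq_matI) (simp_all add: cP del: index_mult_mat)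
  fix w :: "complex vec" assume w: "w \<in> carrier_vec n"
  have "(?M *\<^sub>v w) \<bullet>c w = (\<Sum>k<n. \<Sum>l<n. \<Sum>v\<in>UNIV. ?P v $$ (k, l) * w $ l * cnj (w $ k))"
    using w by (simp add: scalar_prod_def lessThan_atLeast0 sum_distrib_right del: index_mult_mat)
  also have "\<dots> = (\<Sum>k<n. \<Sum>v\<in>UNIV. \<Sum>l<n. ?P v $$ (k, l) * w $ l * cnj (w $ k))"
    by (intro sum.cong refl sum.swap)
  also have "\<dots> = (\<Sum>v\<in>UNIV. \<Sum>k<n. \<Sum>l<n. ?P v $$ (k, l) * w $ l * cnj (w $ k))"
    by (rule sum.swap)
  also have "\<dots> = (\<Sum>v\<in>UNIV. (?P v *\<^sub>v w) \<bullet>c w)"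
  proof (rule sum.cong[OF refl])
    fix v
    have d: "dim_row (?P v) = n" "dim_col (?P v) = n" using Pc[of v] by (metis carrier_matD(1)) (metis Pc carrier_matD(2))
    then show "(\<Sum>k<n. \<Sum>l<n. ?P v $$ (k, l) * w $ l * cnj (w $ k)) = (?P v *\<^sub>v w) \<bullet>c w"
      using w by (simp add: scalar_prod_def lessThan_atLeast0 sum_distrib_right del: index_mult_mat)
  qed
  also have "\<dots> \<ge> 0"
    using P w by (intro sum_nonneg) (auto simp: psd_def)
  finally show "0 \<le> (?M *\<^sub>v w) \<bullet>c w" .
qed

text \<open>The one estimate of the norm on which all later smallness arguments rest. The constant
  is crude: a root of \<open>card UNIV\<close> is replaced by \<open>card UNIV\<close>.\<close>

lemma tuple_norm_le:
  fixes X :: "('v :: finite) tuple"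
  assumes X: "X \<in> tuples n" and n: "n \<ge> 1"
    and b: "\<And>v k l. k < n \<Longrightarrow> l < n \<Longrightarrow> cmod (X v $$ (k, l)) \<le> b"
  shows "tuple_norm n X \<le> real n * real (card (UNIV :: 'v set)) * b"
proof -
  let ?M = "mat n n (\<lambda>(k, l). \<Sum>v\<in>UNIV. (X v * mat_adjoint (X v)) $$ (k, l))"
  have b0: "b \<ge> 0" using b[of 0 0] n norm_ge_zero order_trans
    by (metis less_eq_Suc_le One_nat_def)
  have Xc: "X v \<in> carrier_mat n n" for v using X by (simp add: tuples_def)
  have "cmod (?M $$ (k, l)) \<le> real (card (UNIV :: 'v set)) * (real n * (b * b))" if kl: "k < n" "l < n" for k l
  proof -
    have "(X v * mat_adjoint (X v)) $$ (k, l) = (\<Sum>i<n. X v $$ (k, i) * cnj (X v $$ (l, i)))" for v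
      using Xc[of v] kl by (simp add: scalar_prod_def lessThan_atLeast0)
    moreover have "cmod (\<Sum>i<n. X v $$ (k, i) * cnj (X v $$ (l, i))) \<le> real n * (b * b)" for v
    proof -
      have "cmod (\<Sum>i<n. X v $$ (k, i) * cnj (X v $$ (l, i))) \<le> (\<Sum>i<n. b * b)"
        using b kl b0 by (intro sum_norm_le) (auto simp: norm_mult intro!: mult_mono)
      then show ?thesis by simp
    qed
    ultimately have "cmod (?M $$ (k, l)) \<le> (\<Sum>v\<in>(UNIV :: 'v set). real n * (b * b))"
      using kl by (simp del: index_mult_mat sum_constant) (intro sum_norm_le, simp)
    then show ?thesis by simp
  qed
  from max_eigenvalue_sqrt_le[OF psd_sum_mult_adjoint[OF X] n this]
  have "tuple_norm n X \<le> sqrt (real n * (real (card (UNIV :: 'v set)) * (real n * (b * b))))"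
    by (simp add: tuple_norm_def)
  also have "\<dots> \<le> sqrt ((real n * real (card (UNIV :: 'v set)) * b) ^ 2)"
  proof (rule real_sqrt_le_mono)
    have "real n * (real (card (UNIV :: 'v set)) * (real n * (b * b))) = (real n * b) ^ 2 * (real (card (UNIV :: 'v set)) * 1)"
      by (simp add: power2_eq_square)
    also have "\<dots> \<le> (real n * b) ^ 2 * (real (card (UNIV :: 'v set)) * real (card (UNIV :: 'v set)))"
      by (intro mult_left_mono) (auto simp: Suc_le_eq card_gt_0_iff)
    finally show "real n * (real (card (UNIV :: 'v set)) * (real n * (b * b))) \<le> (real n * real (card (UNIV :: 'v set)) * b)\<^sup>2"
      by (simp add: power2_eq_square mult_ac)
  qed
  also have "\<dots> = real n * real (card (UNIV :: 'v set)) * b" using b0 by simp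
  finally show ?thesis .
qed

section \<open>Pringsheim's theorem and nonnegative Hankel forms\<close>

text \<open>Differentiation preserves nonnegative coefficients, so the induction on k lets F vary.
  For complex numbers, nonnegative includes being real.\<close>

lemma eval_fps_nonneg_higher_deriv:
  fixes F :: "complex fps"
  assumes "\<And>n. 0 \<le> fps_nth F n" "0 \<le> t" "ereal t < fps_conv_radius F"
  shows "0 \<le> (deriv ^^ k) (eval_fps F) (complex_of_real t)"
  using assms
proof (induction k arbitrary: F)
  case 0
  have "(\<lambda>n. fps_nth F n * complex_of_real t ^ n) sums eval_fps F (complex_of_real t)"
    using 0(2,3) by (intro sums_eval_fps) simp
  from sums_Re[OF this] sums_Im[OF this]
  have sums: "(\<lambda>n. Re (fps_nth F n) * t ^ n) sums Re (eval_fps F (complex_of_real t))"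
    "(\<lambda>n. 0 :: real) sums Im (eval_fps F (complex_of_real t))"
    using 0(1) by (simp_all add: less_eq_complex_def flip: of_real_power)
  have "0 \<le> Re (eval_fps F (complex_of_real t))"
    using sums(1) 0(1,2) by (intro sums_le[OF _ sums_zero sums(1)]) (simp add: less_eq_complex_def)
  moreover have "Im (eval_fps F (complex_of_real t)) = 0"
    using sums(2) sums_zero sums_unique2 by blast
  ultimately show ?case by (simp add: less_eq_complex_def)
next
  case (Suc k)
  let ?S = "eball 0 (fps_conv_radius F) :: complex set"
  have "(deriv ^^ Suc k) (eval_fps F) (complex_of_real t)
      = (deriv ^^ k) (deriv (eval_fps F)) (complex_of_real t)"
    by (simp only: funpow_Suc_right o_apply)
  also have "\<dots> = (deriv ^^ k) (eval_fps (fps_deriv F)) (complex_of_real t)"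
    using Suc.prems fps_conv_radius_deriv[of F]
    by (intro higher_deriv_transform_within_open[of _ ?S])
      (auto intro!: holomorphic_intros holomorphic_deriv simp: eval_fps_deriv less_le_trans)
  also have "\<dots> \<ge> 0"
    using Suc.prems fps_conv_radius_deriv[of F]
    by (intro Suc.IH) (auto simp: less_eq_complex_def less_le_trans)
  finally show ?case .
qed

text \<open>If the radius r were finite, the Taylor series of \<open>h\<close> about a point
  \<open>t0\<close> just below r would reach a point \<open>t1\<close> above r. After subtraction of
  any partial sum the Taylor coefficients at \<open>t0\<close> are still nonnegative, so every
  partial sum at \<open>t1\<close> is at most \<open>h t1\<close>. Bounded sums of nonnegative terms
  converge, so the radius would exceed r. The comparison with partial sums replaces the usual
  interchange of a double series.\<close>

lemma pringsheim:
  fixes b :: "nat \<Rightarrow> real"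
  assumes S: "open S" "\<And>t. t \<ge> 0 \<Longrightarrow> complex_of_real t \<in> S" and h: "h holomorphic_on S"
    and b: "\<And>n. b n \<ge> 0"
    and \<epsilon>: "\<epsilon> > 0"
    and sums: "\<And>t. 0 \<le> t \<Longrightarrow> t < \<epsilon> \<Longrightarrow> (\<lambda>n. complex_of_real (b n * t ^ n)) sums h (complex_of_real t)"
    and t: "t \<ge> 0"
  shows "summable (\<lambda>n. b n * t ^ n)"
proof -
  define F where "F = Abs_fps (\<lambda>n. complex_of_real (b n))"
  have R_ge: "ereal \<epsilon> \<le> fps_conv_radius F"
    unfolding fps_conv_radius_def
  proof (rule conv_radius_geI_ex')
    fix r assume "0 < r" "ereal r < ereal \<epsilon>"
    then show "summable (\<lambda>n. fps_nth F n * of_real r ^ n)"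
      using sums[of r] by (simp add: F_def sums_iff)
  qed
  have "fps_conv_radius F = \<infinity>"
  proof (rule ccontr)
    assume "fps_conv_radius F \<noteq> \<infinity>"
    with R_ge obtain r where r: "fps_conv_radius F = ereal r" "r \<ge> \<epsilon>"
      by (cases "fps_conv_radius F") auto
    have "complex_of_real r \<in> S" using r \<epsilon> S(2)[of r] by simp
    then obtain d where d: "d > 0" "ball (complex_of_real r) d \<subseteq> S"
      using S(1) by (auto simp: open_contains_ball)
    \<comment> \<open>\<open>d / 4\<close> puts the disc of radius \<open>3 * \<rho>\<close> about
      \<open>t0\<close> inside the disc of radius d about r; \<open>r / 2\<close> keeps
      \<open>t0\<close> positive. The distance from \<open>t0\<close> to \<open>t1\<close> is
      \<open>2 * \<rho>\<close>.\<close>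
    define \<rho> where "\<rho> = min (d / 4) (r / 2)"
    have \<rho>: "\<rho> > 0" "4 * \<rho> \<le> d" "\<rho> < r" using d r \<epsilon> by (auto simp: \<rho>_def)
    define t0 t1 where "t0 = r - \<rho>" and "t1 = r + \<rho>"
    have t0: "0 < t0" "t0 < r" using \<rho> by (auto simp: t0_def)
    have ball_S: "ball (complex_of_real t0) (3 * \<rho>) \<subseteq> S"
    proof
      fix z assume "z \<in> ball (complex_of_real t0) (3 * \<rho>)"
      moreover have "dist (complex_of_real r) (complex_of_real t0) = \<rho>"
        using \<rho> by (simp add: dist_of_real t0_def dist_norm)
      ultimately have "dist (complex_of_real r) z < d"
        using dist_triangle[of "complex_of_real r" z "complex_of_real t0"] \<rho> by simp
      with d show "z \<in> S" by auto
    qed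
    \<comment> \<open>\<open>h\<close> equals the series a priori only on a short real interval, but
      comparing derivatives at \<open>t0\<close> needs agreement on an open set. The component of 0
      in \<open>T\<close> contains the segment from 0 to r, and the identity theorem applies on
      it.\<close>
    define T where "T = S \<inter> ball 0 r"
    define C where "C = connected_component_set T 0"
    have T: "open T" "0 \<in> T" using S S(2)[of 0] r \<epsilon> by (auto simp: T_def)
    then have C: "open C" "connected C" "C \<subseteq> T" "0 \<in> C"
      by (auto simp: C_def open_connected_component connected_component_subset)
    have seg: "complex_of_real ` {0..<r} \<subseteq> C"
      unfolding C_def
      using S(2) r \<epsilon> by (intro connected_component_maximal connected_continuous_image continuous_intros)
        (auto simp: T_def)
    have hF: "h z = eval_fps F z" if "z \<in> C" for z
    proof -
      let ?U = "complex_of_real ` {0<..<\<epsilon>}"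
      have "h z - eval_fps F z = 0"
      proof (rule analytic_continuation[of "\<lambda>z. h z - eval_fps F z" C ?U 0 z])
        have "T \<subseteq> S" "T \<subseteq> eball 0 (fps_conv_radius F)" using r by (auto simp: T_def)
        then show "(\<lambda>z. h z - eval_fps F z) holomorphic_on C"
          using C(3) h by (intro holomorphic_intros) (auto intro: holomorphic_on_subset)
        show "?U \<subseteq> C" using seg r by auto
        show "0 islimpt ?U"
          unfolding islimpt_approachable
        proof safe
          fix e :: real assume "e > 0"
          then show "\<exists>x'\<in>?U. x' \<noteq> 0 \<and> dist x' 0 < e"
            using \<epsilon> by (intro bexI[OF _ imageI[of "min e \<epsilon> / 2"]]) (auto simp: dist_norm)
        qed
        show "h z - eval_fps F z = 0" if "z \<in> ?U" for z
        proof -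
          obtain t where "z = complex_of_real t" "0 < t" "t < \<epsilon>" using \<open>z \<in> ?U\<close> by auto
          then show ?thesis using sums[of t] by (simp add: eval_fps_def F_def sums_iff)
        qed
      qed (use C that in auto)
      then show ?thesis by simp
    qed
    have partial: "(\<Sum>n<N. b n * t1 ^ n) \<le> Re (h (complex_of_real t1))" for N
    proof -
      define P where "P z = (\<Sum>n<N. complex_of_real (b n) * z ^ n)" for z
      \<comment> \<open>The tail from N on, which is the series of \<open>h - P\<close>: same
        radius, coefficients still nonnegative.\<close>
      define Q where "Q = Abs_fps (\<lambda>n. if n < N then 0 else complex_of_real (b n))"
      have "fps_conv_radius Q = fps_conv_radius F"
        unfolding fps_conv_radius_def
        by (intro conv_radius_cong eventually_sequentiallyI[of N]) (simp add: Q_def F_def)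
      then have radQ: "fps_conv_radius Q = ereal r" using r by simp
      have Q_eq: "eval_fps Q z = h z - P z" if "z \<in> C" for z
      proof -
        have "z \<in> eball 0 (fps_conv_radius F)" using that C(3) r by (auto simp: T_def)
        then have "(\<lambda>n. fps_nth F n * z ^ n) sums h z"
          using hF[OF that] sums_eval_fps[of z F] by simp
        moreover have "(\<lambda>n. if n \<in> {..<N} then fps_nth F n * z ^ n else 0) sums P z"
          unfolding P_def F_def fps_nth_Abs_fps by (rule sums_If_finite_set) simp
        ultimately have "(\<lambda>n. fps_nth F n * z ^ n - (if n \<in> {..<N} then fps_nth F n * z ^ n else 0))
            sums (h z - P z)"
          by (rule sums_diff)
        also have "(\<lambda>n. fps_nth F n * z ^ n - (if n \<in> {..<N} then fps_nth F n * z ^ n else 0))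
            = (\<lambda>n. fps_nth Q n * z ^ n)"
          by (auto simp: fun_eq_iff Q_def F_def)
        finally show ?thesis by (simp add: eval_fps_def sums_iff)
      qed
      have holP: "P holomorphic_on A" for A
        unfolding P_def by (intro holomorphic_intros)
      have "(\<lambda>k. (deriv ^^ k) (\<lambda>z. h z - P z) (complex_of_real t0) / fact k *
          (complex_of_real t1 - complex_of_real t0) ^ k) sums (h (complex_of_real t1) - P (complex_of_real t1))"
      proof (rule holomorphic_power_series[of _ _ "3 * \<rho>"])
        show "(\<lambda>z. h z - P z) holomorphic_on ball (complex_of_real t0) (3 * \<rho>)"
          using holomorphic_on_subset[OF h ball_S] holP by (intro holomorphic_intros)
        show "complex_of_real t1 \<in> ball (complex_of_real t0) (3 * \<rho>)"
          using \<rho> by (simp add: dist_of_real t0_def t1_def dist_norm)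
      qed
      also have "(\<lambda>k. (deriv ^^ k) (\<lambda>z. h z - P z) (complex_of_real t0) / fact k *
          (complex_of_real t1 - complex_of_real t0) ^ k) =
          (\<lambda>k. (deriv ^^ k) (eval_fps Q) (complex_of_real t0) * complex_of_real ((2 * \<rho>) ^ k / fact k))"
      proof
        fix k
        have "C \<subseteq> eball 0 (fps_conv_radius Q)" using C(3) radQ by (auto simp: T_def)
        then have "(deriv ^^ k) (\<lambda>z. h z - P z) (complex_of_real t0) = (deriv ^^ k) (eval_fps Q) (complex_of_real t0)"
          using holomorphic_on_subset[OF h] C(1,3) holP seg t0 Q_eq
          by (intro higher_deriv_transform_within_open[of _ C]) (auto intro!: holomorphic_intros simp: T_def)
        then show "(deriv ^^ k) (\<lambda>z. h z - P z) (complex_of_real t0) / fact k *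
            (complex_of_real t1 - complex_of_real t0) ^ k =
          (deriv ^^ k) (eval_fps Q) (complex_of_real t0) * complex_of_real ((2 * \<rho>) ^ k / fact k)"
          by (simp add: t0_def t1_def)
      qed
      finally have sums_Q: "(\<lambda>k. Re ((deriv ^^ k) (eval_fps Q) (complex_of_real t0) *
          complex_of_real ((2 * \<rho>) ^ k / fact k))) sums Re (h (complex_of_real t1) - P (complex_of_real t1))"
        by (rule sums_Re)
      have nonneg_Q: "0 \<le> Re ((deriv ^^ k) (eval_fps Q) (complex_of_real t0) *
          complex_of_real ((2 * \<rho>) ^ k / fact k))" for k
      proof -
        have "0 \<le> (deriv ^^ k) (eval_fps Q) (complex_of_real t0)"
          using b t0 radQ by (intro eval_fps_nonneg_higher_deriv) (auto simp: Q_def less_eq_complex_def)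
        then show ?thesis
          using \<rho> by (simp add: less_eq_complex_def del: of_real_divide of_real_mult of_real_power)
      qed
      have "0 \<le> Re (h (complex_of_real t1) - P (complex_of_real t1))"
        by (rule sums_le[OF nonneg_Q sums_zero sums_Q])
      moreover have "P (complex_of_real t1) = complex_of_real (\<Sum>n<N. b n * t1 ^ n)"
        by (simp add: P_def)
      ultimately show ?thesis by simp
    qed
    have "t1 > 0" using \<rho> r \<epsilon> by (simp add: t1_def)
    then have "summable (\<lambda>n. b n * t1 ^ n)"
      using b partial
      by (intro bounded_imp_summable[where B = "Re (h (complex_of_real t1))"])
        (auto simp only: lessThan_Suc_atMost[symmetric] zero_le_mult_iff zero_le_power less_imp_le)
    then have "summable (\<lambda>n. fps_nth F n * complex_of_real t1 ^ n)"
      using summable_of_real[of "\<lambda>n. b n * t1 ^ n", where 'a = complex] by (simp add: F_def)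
    then have "ereal (norm (complex_of_real t1)) \<le> fps_conv_radius F"
      unfolding fps_conv_radius_def by (rule conv_radius_geI)
    with r \<open>t1 > 0\<close> have "t1 \<le> r" by simp
    with \<rho> show False by (simp add: t1_def)
  qed
  then have "summable (\<lambda>n. fps_nth F n * complex_of_real t ^ n)"
    by (intro summable_fps) simp
  then have "summable (\<lambda>n. Re (fps_nth F n * complex_of_real t ^ n))"
    by (rule summable_Re)
  then show ?thesis by (simp add: F_def flip: of_real_power)
qed


section \<open>Consequences of a nonnegative Hankel form\<close>

lemma nonneg_quadratic_form_imp_square_le:
  fixes p q r :: real
  assumes "\<And>a b. 0 \<le> a\<^sup>2 * p + 2 * a * b * q + b\<^sup>2 * r"
  shows "q\<^sup>2 \<le> p * r"
proof (cases "r = 0")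
  case True
  have "q = 0"
  proof (rule ccontr)
    assume "q \<noteq> 0"
    \<comment> \<open>For r = 0 the form is affine in b; at this b it equals -1.\<close>
    with assms[of 1 "- (p + 1) / (2 * q)"] True show False by (simp add: field_simps)
  qed
  with True show ?thesis by simp
next
  case False
  then have "r > 0" using assms[of 0 1] by simp
  \<comment> \<open>For fixed a the form is least at b = - a q / r; scaling by r gives the pair (r,
    - q).\<close>
  have "0 \<le> r * (p * r - q\<^sup>2)"
    using assms[of r "- q"] by (simp add: power2_eq_square algebra_simps)
  then show ?thesis using \<open>r > 0\<close> by (simp add: zero_le_mult_iff)
qed

lemma hankel_nonneg_binary_form:
  fixes c :: "nat \<Rightarrow> complex"
  assumes "\<And>N \<xi>. 0 \<le> (\<Sum>i\<le>N. \<Sum>j\<le>N. c (i + j) * complex_of_real (\<xi> i * \<xi> j))"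
  shows "0 \<le> complex_of_real (a\<^sup>2) * c (2 * i) + complex_of_real (2 * a * b) * c (i + j)
    + complex_of_real (b\<^sup>2) * c (2 * j)"
proof -
  let ?u = "\<lambda>k. (if k = i then complex_of_real a else 0)"
  let ?v = "\<lambda>k. (if k = j then complex_of_real b else 0)"
  define N where "N = max i j"
  have N: "i \<le> N" "j \<le> N" by (auto simp: N_def)
  have double_sum: "(\<Sum>k\<le>N. \<Sum>l\<le>N. c (k + l) * ((if k = m then x else 0) * (if l = n then y else 0)))
      = c (m + n) * (x * y)" if "m \<le> N" "n \<le> N" for m n x y
  proof -
    have "(\<Sum>k\<le>N. \<Sum>l\<le>N. c (k + l) * ((if k = m then x else 0) * (if l = n then y else 0)))
        = (\<Sum>k\<le>N. if k = m then c (k + n) * (x * y) else 0)"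
    proof (intro sum.cong refl)
      fix k
      have "(\<Sum>l\<le>N. c (k + l) * ((if k = m then x else 0) * (if l = n then y else 0)))
          = (\<Sum>l\<le>N. if l = n then c (k + l) * ((if k = m then x else 0) * y) else 0)"
        by (intro sum.cong) auto
      also have "\<dots> = c (k + n) * ((if k = m then x else 0) * y)"
        using that by (subst sum.delta) auto
      finally show "(\<Sum>l\<le>N. c (k + l) * ((if k = m then x else 0) * (if l = n then y else 0)))
          = (if k = m then c (k + n) * (x * y) else 0)" by simp
    qed
    also have "\<dots> = c (m + n) * (x * y)"
      using that by (subst sum.delta) auto
    finally show ?thesis .
  qed
  \<comment> \<open>A sum of two indicators rather than a case distinction, so that
    \<open>i = j\<close> is covered.\<close>
  let ?x = "\<lambda>k. (if k = i then a else 0) + (if k = j then b else 0)"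
  have "(\<Sum>k\<le>N. \<Sum>l\<le>N. c (k + l) * complex_of_real (?x k * ?x l))
      = (\<Sum>k\<le>N. \<Sum>l\<le>N. c (k + l) * (?u k * ?u l) + c (k + l) * (?u k * ?v l)
          + c (k + l) * (?v k * ?u l) + c (k + l) * (?v k * ?v l))"
    by (intro sum.cong refl) (auto simp: algebra_simps)
  also have "\<dots> = c (i + i) * (a * a) + c (i + j) * (a * b) + c (j + i) * (b * a) + c (j + j) * (b * b)"
    unfolding sum.distrib double_sum[OF N(1) N(1)] double_sum[OF N(1) N(2)]
      double_sum[OF N(2) N(1)] double_sum[OF N(2) N(2)] by simp
  also have "\<dots> = complex_of_real (a\<^sup>2) * c (2 * i) + complex_of_real (2 * a * b) * c (i + j)
    + complex_of_real (b\<^sup>2) * c (2 * j)"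
    unfolding mult_2[of i] mult_2[of j] by (simp add: power2_eq_square algebra_simps)
  finally show ?thesis using assms[where N = N and \<xi> = ?x] by simp
qed

lemma hankel_nonneg_entire_imp_zero:
  fixes c :: "nat \<Rightarrow> complex"
  assumes hankel: "\<And>N \<xi>. 0 \<le> (\<Sum>i\<le>N. \<Sum>j\<le>N. c (i + j + 2) * complex_of_real (\<xi> i * \<xi> j))"
    and S: "open S" "range complex_of_real \<subseteq> S" and h: "h holomorphic_on S"
    and \<epsilon>: "\<epsilon> > 0"
    and sums: "\<And>t. \<bar>t\<bar> < \<epsilon> \<Longrightarrow> (\<lambda>n. c n * complex_of_real t ^ n) sums h (complex_of_real t)"
    and n: "n \<ge> 3"
  shows "c n = 0"
proof -
  define s where "s n = Re (c (n + 2))" for n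
  note form = hankel_nonneg_binary_form[of "\<lambda>n. c (n + 2)", OF hankel]
  have Re_form: "0 \<le> a\<^sup>2 * s (2 * i) + 2 * a * b * s (i + j) + b\<^sup>2 * s (2 * j)" for a b i j
    using form[of a i b j] by (simp add: less_eq_complex_def s_def del: of_real_mult of_real_power)
  have Im_form: "a\<^sup>2 * Im (c (2 * i + 2)) + 2 * a * b * Im (c (i + j + 2)) + b\<^sup>2 * Im (c (2 * j + 2)) = 0"
    for a b i j
    using form[of a i b j] by (simp add: less_eq_complex_def del: of_real_mult of_real_power)
  \<comment> \<open>The diagonal entries are real by two choices of (a, b); the cross term of
    indices 0 and n then settles every \<open>c (n + 2)\<close>.\<close>
  have Im0: "Im (c (n + 2)) = 0" for n
    using Im_form[of 1 0 0 n] Im_form[of 0 0 1 n] Im_form[of 1 0 1 n] by simp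
  have c_eq: "c (n + 2) = complex_of_real (s n)" for n
    using Im0[of n] by (simp add: s_def complex_eq_iff)
  have s_nonneg: "0 \<le> s (2 * n)" for n
    using Re_form[of 1 n 0 n] by simp
  have s_square: "(s (i + j))\<^sup>2 \<le> s (2 * i) * s (2 * j)" for i j
    using nonneg_quadratic_form_imp_square_le[OF Re_form] .
  have "s 2 = 0"
  proof (rule ccontr)
    assume "s 2 \<noteq> 0"
    then have "0 < (s 2)\<^sup>2" by simp
    also have "(s 2)\<^sup>2 \<le> s 0 * s 4" using s_square[of 0 2] by (simp add: eval_nat_numeral)
    finally have "s 0 \<noteq> 0" by auto
    then have s0: "s 0 > 0" and s2: "s 2 > 0"
      using s_nonneg[of 0] s_nonneg[of 1] \<open>s 2 \<noteq> 0\<close> by auto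
    define q where "q = s 2 / s 0"
    have q: "q > 0" using s0 s2 by (simp add: q_def)
    \<comment> \<open>Log-convexity makes the ratios \<open>s (2 * Suc n) / s (2 * n)\<close>
      nondecreasing, so they never fall below the first one, \<open>q\<close>. Positivity is carried
      along to permit division.\<close>
    have growth: "s (2 * n) > 0 \<and> s (2 * Suc n) \<ge> q * s (2 * n)" for n
    proof (induction n)
      case 0
      then show ?case using s0 by (simp add: q_def)
    next
      case (Suc n)
      let ?a = "s (2 * n)" and ?b = "s (2 * Suc n)" and ?d = "s (2 * Suc (Suc n))"
      have b: "?b > 0" using Suc q by (meson less_le_trans mult_pos_pos)
      have "n + Suc (Suc n) = 2 * Suc n" by simp
      then have "?b * ?b \<le> ?a * ?d"
        using s_square[of n "Suc (Suc n)"] by (simp only: power2_eq_square)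
      moreover have "?a \<le> ?b / q" using Suc q by (simp add: field_simps)
      ultimately have "?b * ?b \<le> ?b / q * ?d"
        using s_nonneg[of "Suc (Suc n)"] by (meson mult_right_mono order_trans)
      then have "q * ?b \<le> ?d" using b q by (simp add: field_simps)
      with b show ?case by simp
    qed
    have lower: "s 0 * q ^ n \<le> s (2 * n)" for n
    proof (induction n)
      case (Suc n)
      have "s 0 * q ^ Suc n = q * (s 0 * q ^ n)" by simp
      also have "\<dots> \<le> q * s (2 * n)" using Suc q by (intro mult_left_mono) auto
      also have "\<dots> \<le> s (2 * Suc n)" using growth by blast
      finally show ?case .
    qed simp
    \<comment> \<open>Only even coefficients have a known sign, hence the even part of
      \<open>h\<close>; \<open>c 0\<close> lies outside the Hankel form and is subtracted.
      \<open>T\<close> is the symmetric domain on which \<open>h\<close> is available at both z and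
      -z.\<close>
    define b where "b n = (if even n \<and> n \<ge> 2 then Re (c n) else 0)" for n
    define T where "T = S \<inter> uminus ` S"
    have memT: "z \<in> T \<longleftrightarrow> z \<in> S \<and> - z \<in> S" for z
      by (auto simp: T_def image_iff) (metis minus_minus)
    have "summable (\<lambda>n. b n * t ^ n)" if t: "t \<ge> 0" for t
    proof (rule pringsheim[where S = T and h = "\<lambda>z. (h z + h (- z)) / 2 - c 0"])
      show "open T" using S(1) by (simp add: T_def open_negations open_Int)
      show "complex_of_real x \<in> T" if "x \<ge> 0" for x
        using S(2) unfolding memT by (metis of_real_minus range_subsetD)
      show "(\<lambda>z. (h z + h (- z)) / 2 - c 0) holomorphic_on T"
      proof -
        have "h holomorphic_on T" "(h \<circ> uminus) holomorphic_on T"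
          using h by (auto intro!: holomorphic_on_compose_gen[where t = S] holomorphic_intros
              intro: holomorphic_on_subset simp: memT)
        then show ?thesis by (auto simp: o_def intro!: holomorphic_intros)
      qed
      show "b n \<ge> 0" for n
      proof (cases "even n \<and> n \<ge> 2")
        case True
        then obtain m where "n = 2 * m" "m \<ge> 1" by (auto elim!: evenE)
        then have "n = 2 * (m - 1) + 2" by simp
        then show ?thesis using s_nonneg[of "m - 1"] by (simp add: b_def s_def)
      qed (auto simp: b_def)
      show "(\<lambda>n. complex_of_real (b n * x ^ n)) sums
          ((h (complex_of_real x) + h (- complex_of_real x)) / 2 - c 0)" if "0 \<le> x" "x < \<epsilon>" for x
      proof -
        have "(\<lambda>n. (c n * complex_of_real x ^ n + c n * complex_of_real (- x) ^ n) / 2 -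
            (if n = 0 then c n else 0)) sums
            ((h (complex_of_real x) + h (complex_of_real (- x))) / 2 - c 0)"
          using that by (intro sums_diff sums_divide sums_add sums sums_single) auto
        also have "(\<lambda>n. (c n * complex_of_real x ^ n + c n * complex_of_real (- x) ^ n) / 2 -
            (if n = 0 then c n else 0)) = (\<lambda>n. complex_of_real (b n * x ^ n))"
        proof
          fix n
          show "(c n * complex_of_real x ^ n + c n * complex_of_real (- x) ^ n) / 2 -
            (if n = 0 then c n else 0) = complex_of_real (b n * x ^ n)"
          proof (cases "even n \<and> n \<ge> 2")
            case True
            then have "c n = complex_of_real (Re (c n))"
              using Im0[of "n - 2"] by (metis complex_is_Real_iff le_add_diff_inverse2 of_real_Re)
            with True show ?thesis by (simp add: b_def)
          next
            case False
            then have "n = 0 \<or> odd n" by presburger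
            then show ?thesis by (auto simp: b_def)
          qed
        qed
        finally show ?thesis by simp
      qed
    qed (use \<epsilon> t in auto)
    \<comment> \<open>At this t the growth of \<open>s\<close> keeps the terms of index 2n + 2 above
      \<open>s 0 / q\<close>, so they cannot tend to 0.\<close>
    then have "summable (\<lambda>n. b n * (1 / sqrt q) ^ n)" using q by simp
    then have "(\<lambda>n. b n * (1 / sqrt q) ^ n) \<longlonglongrightarrow> 0" by (rule summable_LIMSEQ_zero)
    then have "(\<lambda>n. b (2 * n + 2) * (1 / sqrt q) ^ (2 * n + 2)) \<longlonglongrightarrow> 0"
      by (rule LIMSEQ_subseq_LIMSEQ[unfolded o_def]) (auto simp: strict_mono_def)
    moreover have "s 0 / q \<le> b (2 * n + 2) * (1 / sqrt q) ^ (2 * n + 2)" for n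
    proof -
      have "(1 / sqrt q) ^ (2 * n + 2) = ((1 / sqrt q)\<^sup>2) ^ (n + 1)"
        by (subst power_mult[symmetric]) simp
      also have "\<dots> = 1 / (q ^ n * q)" using q by (simp add: power_divide)
      finally have "b (2 * n + 2) * (1 / sqrt q) ^ (2 * n + 2) = s (2 * n) / (q ^ n * q)"
        by (simp add: b_def s_def)
      moreover have "s 0 / q = s 0 * q ^ n / (q ^ n * q)" using q by simp
      moreover have "s 0 * q ^ n / (q ^ n * q) \<le> s (2 * n) / (q ^ n * q)"
        using q lower[of n] by (intro divide_right_mono) auto
      ultimately show ?thesis by simp
    qed
    ultimately have "s 0 / q \<le> 0" by (intro LIMSEQ_le_const) auto
    with s0 q show False by (simp add: divide_le_0_iff)
  qed
  \<comment> \<open>With i = 1 the vanishing factor \<open>s 2\<close> appears. Index 1 + (n - 3) of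
    \<open>s\<close> is index n of \<open>c\<close>, which is where n \<ge> 3 enters.\<close>
  then have "(s (1 + (n - 3)))\<^sup>2 \<le> 0" using s_square[of 1 "n - 3"] by simp
  moreover have "1 + (n - 3) = n - 2" "n - 2 + 2 = n" using n by simp_all
  ultimately show ?thesis using c_eq[of "n - 2"] by (simp only: power2_less_eq_zero_iff of_real_0)
qed

section \<open>Walks on a bordered path\<close>

text \<open>\<open>mat_iter m A p\<close> is \<open>A\<^sup>p e\<^sub>0\<close> for the m x m matrix A.\<close>
fun mat_iter :: "nat \<Rightarrow> (nat \<Rightarrow> nat \<Rightarrow> real) \<Rightarrow> nat \<Rightarrow> nat \<Rightarrow> real" where
  "mat_iter m A 0 n = (if n = 0 then 1 else 0)"
| "mat_iter m A (Suc p) n = (\<Sum>l<m. A n l * mat_iter m A p l)"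

text \<open>The strictly lower triangle of the edge weights with the powers of
  \<open>\<delta>\<close> removed: rows up to N hold the path edges, row N + 1 the border
  weights.\<close>

definition border_lower :: "nat \<Rightarrow> (nat \<Rightarrow> real) \<Rightarrow> nat \<Rightarrow> nat \<Rightarrow> real" where
  "border_lower N \<xi> n l =
     (if n = Suc N \<and> l \<le> N then \<xi> l else if n \<le> N \<and> n = Suc l then 1 else 0)"

text \<open>The exponent is |n - l|, so a path edge gets \<open>\<delta>\<close> and the border edge
  at l gets \<open>\<delta>^(N+1-l)\<close>. Truncated subtraction is harmless because at most one
  summand is nonzero.\<close>

definition border_path :: "nat \<Rightarrow> (nat \<Rightarrow> real) \<Rightarrow> real \<Rightarrow> nat \<Rightarrow> nat \<Rightarrow> real" where
  "border_path N \<xi> \<delta> n l =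
     \<delta> ^ (n - l) * border_lower N \<xi> n l + \<delta> ^ (l - n) * border_lower N \<xi> l n"

text \<open>The conjugate of \<open>border_path\<close> by the diagonal matrix of the powers \<open>\<delta>\<^sup>n\<close>. Unlike
  \<open>border_path\<close>, it has a nontrivial limit at \<open>\<delta> = 0\<close>, namely \<open>border_lower\<close>.\<close>
definition border_scaled :: "nat \<Rightarrow> (nat \<Rightarrow> real) \<Rightarrow> real \<Rightarrow> nat \<Rightarrow> nat \<Rightarrow> real" where
  "border_scaled N \<xi> \<delta> n l =
     border_lower N \<xi> n l + \<delta> ^ (2 * (l - n)) * border_lower N \<xi> l n"

definition path_walk :: "nat \<Rightarrow> (nat \<Rightarrow> real) \<Rightarrow> real \<Rightarrow> nat \<Rightarrow> nat \<Rightarrow> real" where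
  "path_walk N \<xi> \<delta> = mat_iter (N + 2) (border_path N \<xi> \<delta>)"

definition scaled_walk :: "nat \<Rightarrow> (nat \<Rightarrow> real) \<Rightarrow> real \<Rightarrow> nat \<Rightarrow> nat \<Rightarrow> real" where
  "scaled_walk N \<xi> \<delta> = mat_iter (N + 2) (border_scaled N \<xi> \<delta>)"

lemma border_lower_eq_0: "n \<le> l \<Longrightarrow> border_lower N \<xi> n l = 0"
  by (auto simp: border_lower_def)

lemma border_path_sym: "border_path N \<xi> \<delta> n l = border_path N \<xi> \<delta> l n"
  by (simp add: border_path_def)

text \<open>The conjugation by the diagonal matrix, written without its inverse so that it also
  holds at \<open>\<delta> = 0\<close>.\<close>

lemma border_path_scaled:
  "border_path N \<xi> \<delta> n l * \<delta> ^ l = \<delta> ^ n * border_scaled N \<xi> \<delta> n l"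
proof (cases "n \<le> l")
  case True
  then have "l - n + l = n + 2 * (l - n)" by arith
  then have "\<delta> ^ (l - n) * \<delta> ^ l = \<delta> ^ n * \<delta> ^ (2 * (l - n))"
    by (simp only: power_add[symmetric])
  with True show ?thesis
    by (simp add: border_path_def border_scaled_def border_lower_eq_0)
next
  case False
  then have "\<delta> ^ (n - l) * \<delta> ^ l = \<delta> ^ n"
    by (simp flip: power_add)
  with False show ?thesis
    by (simp add: border_path_def border_scaled_def border_lower_eq_0)
qed

lemma path_walk_scaled: "path_walk N \<xi> \<delta> p n = \<delta> ^ n * scaled_walk N \<xi> \<delta> p n"
proof (induction p arbitrary: n)
  case (Suc p)
  have "path_walk N \<xi> \<delta> (Suc p) n =
      (\<Sum>l<N + 2. border_path N \<xi> \<delta> n l * \<delta> ^ l * scaled_walk N \<xi> \<delta> p l)"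
    using Suc by (simp add: path_walk_def mult_ac)
  also have "\<dots> = \<delta> ^ n * scaled_walk N \<xi> \<delta> (Suc p) n"
    unfolding border_path_scaled scaled_walk_def mat_iter.simps sum_distrib_left
    by (simp only: mult_ac)
  finally show ?case .
qed (simp add: path_walk_def scaled_walk_def)

text \<open>Telescoping: walks for A are turned into walks for B one step at a time.\<close>
lemma mat_iter_diff:
  assumes "m > 0" and sym: "\<And>n l. A n l = A l n"
  shows "mat_iter m A k 0 - mat_iter m B k 0 =
    (\<Sum>p<k. \<Sum>n<m. mat_iter m A p n * (\<Sum>l<m. (A n l - B n l) * mat_iter m B (k - 1 - p) l))"
proof -
  \<comment> \<open>The pairing of A^p e_0 with B^q e_0. Symmetry moves one factor A to the other
    side, so raising p and raising q differ by one insertion of A - B.\<close>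
  define f where "f p q = (\<Sum>n<m. mat_iter m A p n * mat_iter m B q n)" for p q
  have step: "f (Suc p) q - f p (Suc q) =
      (\<Sum>n<m. mat_iter m A p n * (\<Sum>l<m. (A n l - B n l) * mat_iter m B q l))" for p q
  proof -
    have "f (Suc p) q = (\<Sum>n<m. \<Sum>l<m. A n l * mat_iter m A p l * mat_iter m B q n)"
      by (simp add: f_def sum_distrib_right)
    also have "\<dots> = (\<Sum>l<m. \<Sum>n<m. A n l * mat_iter m A p l * mat_iter m B q n)"
      by (rule sum.swap)
    also have "\<dots> = (\<Sum>n<m. mat_iter m A p n * (\<Sum>l<m. A n l * mat_iter m B q l))"
      by (subst sym) (simp add: sum_distrib_left mult_ac)
    finally show ?thesis
      by (simp add: f_def sum_subtractf right_diff_distrib left_diff_distrib)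
  qed
  have f0: "f p 0 = mat_iter m A p 0" "f 0 p = mat_iter m B p 0" for p
    using assms(1) by (simp_all add: f_def sum.delta if_distrib[of "\<lambda>x. _ * x"]
        if_distrib[of "\<lambda>x. x * _"] cong: if_cong)
  have "mat_iter m A k 0 - mat_iter m B k 0 = f k (k - k) - f 0 (k - 0)" by (simp add: f0)
  also have "\<dots> = (\<Sum>p<k. f (Suc p) (k - Suc p) - f p (k - p))"
    by (simp only: sum_lessThan_telescope[where f = "\<lambda>p. f p (k - p)"])
  also have "\<dots> = (\<Sum>p<k. f (Suc p) (k - 1 - p) - f p (Suc (k - 1 - p)))"
    by (intro sum.cong refl) (simp add: Suc_diff_Suc)
  finally show ?thesis by (simp only: step)
qed

lemma path_walk_0_border: "path_walk N (\<lambda>_. 0) \<delta> p (Suc N) = 0"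
proof (cases p)
  case (Suc q)
  have "border_path N (\<lambda>_. 0) \<delta> (Suc N) l = 0" if "l < N + 2" for l
    using that by (auto simp: border_path_def border_lower_def)
  then show ?thesis by (simp add: path_walk_def Suc)
qed (simp add: path_walk_def)

text \<open>A closed walk at 0 through the border is cut at its last visit to the vertex N + 1: p
  steps to get there, the edge to l, and k - 1 - p steps on the path alone. In terms of scaled walks
  this is a polynomial in \<open>\<delta>\<close>, meaningful at 0.\<close>

definition walk_gap :: "nat \<Rightarrow> (nat \<Rightarrow> real) \<Rightarrow> nat \<Rightarrow> real \<Rightarrow> real" where
  "walk_gap N \<xi> k \<delta> = (\<Sum>p<k. scaled_walk N \<xi> \<delta> p (Suc N) *
     (\<Sum>l\<le>N. \<xi> l * scaled_walk N (\<lambda>_. 0) \<delta> (k - 1 - p) l))"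

text \<open>In the cut walk, the part up to the border vertex carries \<open>\<delta>^(N+1)\<close>
  by \<open>path_walk_scaled\<close>; the edge \<open>\<delta>^(N+1-l)\<close> and the return
  \<open>\<delta>^l\<close> carry the same power together.\<close>

lemma path_walk_diff:
  "path_walk N \<xi> \<delta> k 0 - path_walk N (\<lambda>_. 0) \<delta> k 0 = \<delta> ^ (2 * N + 2) * walk_gap N \<xi> k \<delta>"
proof -
  let ?A = "border_path N \<xi> \<delta>" and ?B = "border_path N (\<lambda>_. 0) \<delta>"
  have inner: "(\<Sum>n<N + 2. path_walk N \<xi> \<delta> p n * (\<Sum>l<N + 2. (?A n l - ?B n l) * path_walk N (\<lambda>_. 0) \<delta> q l))
      = \<delta> ^ (2 * N + 2) * (scaled_walk N \<xi> \<delta> p (Suc N) * (\<Sum>l\<le>N. \<xi> l * scaled_walk N (\<lambda>_. 0) \<delta> q l))"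
    for p q
  proof -
    \<comment> \<open>\<open>?A - ?B\<close> lives on the border row and column. The column meets
      the entry that vanishes by \<open>path_walk_0_border\<close>, so only row N + 1
      remains.\<close>
    have row: "(\<Sum>l<N + 2. (?A n l - ?B n l) * path_walk N (\<lambda>_. 0) \<delta> q l) =
        (if n = Suc N then \<delta> ^ Suc N * (\<Sum>l\<le>N. \<xi> l * scaled_walk N (\<lambda>_. 0) \<delta> q l) else 0)"
      if "n < N + 2" for n
    proof -
      have "(\<Sum>l<N + 2. (?A n l - ?B n l) * path_walk N (\<lambda>_. 0) \<delta> q l) =
          (\<Sum>l\<le>N. (?A n l - ?B n l) * path_walk N (\<lambda>_. 0) \<delta> q l)"
        by (simp add: path_walk_0_border lessThan_Suc_atMost)
      also have "\<dots> = (\<Sum>l\<le>N. if n = Suc N then \<delta> ^ Suc N * (\<xi> l * scaled_walk N (\<lambda>_. 0) \<delta> q l) else 0)"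
      proof (intro sum.cong refl)
        fix l assume "l \<in> {..N}"
        then have l: "l \<le> N" by simp
        show "(?A n l - ?B n l) * path_walk N (\<lambda>_. 0) \<delta> q l =
            (if n = Suc N then \<delta> ^ Suc N * (\<xi> l * scaled_walk N (\<lambda>_. 0) \<delta> q l) else 0)"
        proof (cases "n = Suc N")
          case True
          have "\<delta> ^ (Suc N - l) * \<delta> ^ l = \<delta> ^ Suc N"
            using l by (simp flip: power_add)
          then have "\<delta> ^ (Suc N - l) * \<xi> l * (\<delta> ^ l * z) = \<delta> ^ Suc N * (\<xi> l * z)" for z
            by (metis mult.assoc mult.commute)
          moreover have "?A n l - ?B n l = \<delta> ^ (Suc N - l) * \<xi> l"
            using l True by (auto simp: border_path_def border_lower_def)
          ultimately show ?thesis using True by (simp only: path_walk_scaled simp_thms if_True)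
        qed (use l that in \<open>auto simp: border_path_def border_lower_def\<close>)
      qed
      finally show ?thesis by (auto simp: sum_distrib_left)
    qed
    have "(\<Sum>n<N + 2. path_walk N \<xi> \<delta> p n * (\<Sum>l<N + 2. (?A n l - ?B n l) * path_walk N (\<lambda>_. 0) \<delta> q l))
        = (\<Sum>n<N + 2. if n = Suc N then path_walk N \<xi> \<delta> p n *
             (\<delta> ^ Suc N * (\<Sum>l\<le>N. \<xi> l * scaled_walk N (\<lambda>_. 0) \<delta> q l)) else 0)"
      by (intro sum.cong refl) (use row in simp)
    also have "\<dots> = path_walk N \<xi> \<delta> p (Suc N) * (\<delta> ^ Suc N * (\<Sum>l\<le>N. \<xi> l * scaled_walk N (\<lambda>_. 0) \<delta> q l))"
      by (subst sum.delta) auto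
    also have "\<dots> = \<delta> ^ Suc N * \<delta> ^ Suc N *
        (scaled_walk N \<xi> \<delta> p (Suc N) * (\<Sum>l\<le>N. \<xi> l * scaled_walk N (\<lambda>_. 0) \<delta> q l))"
      unfolding path_walk_scaled by (simp only: mult_ac)
    also have "\<delta> ^ Suc N * \<delta> ^ Suc N = \<delta> ^ (2 * N + 2)" by (metis add_Suc add_Suc_right mult_2 add_2_eq_Suc' power_add)
    finally show ?thesis .
  qed
  show ?thesis
    using mat_iter_diff[of "N + 2" ?A k ?B, OF _ border_path_sym]
    unfolding path_walk_def[symmetric] inner by (simp add: walk_gap_def sum_distrib_left)
qed

text \<open>At \<open>\<delta> = 0\<close> only the strictly lower triangle survives, so walks can
  only climb: after p steps they are at p, or at the border vertex by the edge from p - 1, and from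
  there no step leads on.\<close>

lemma scaled_walk_at_0:
  "scaled_walk N \<xi> 0 p n =
    (if n \<le> N then if n = p then 1 else 0
     else if n = Suc N \<and> 1 \<le> p \<and> p \<le> Suc N then \<xi> (p - 1) else 0)"
proof (induction p arbitrary: n)
  case (Suc p)
  \<comment> \<open>The value \<open>0 ^ 0 = 1\<close> occurs for l \<le> n only, where
    \<open>border_lower N \<xi> l n\<close> is 0.\<close>
  have lower: "border_scaled N \<xi> 0 n l = border_lower N \<xi> n l" for n l
    by (cases "n \<le> l") (auto simp: border_scaled_def border_lower_eq_0 power_0_left)
  consider "n = 0" | "n > 0" "n \<le> N" | "n = Suc N" | "n > Suc N"
    by linarith
  then have "(\<Sum>l<N + 2. border_lower N \<xi> n l * scaled_walk N \<xi> 0 p l) =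
    (if n \<le> N then if n = Suc p then 1 else 0
     else if n = Suc N \<and> p \<le> N then \<xi> p else 0)"
  proof cases
    case 2
    then obtain k where k: "n = Suc k" by (cases n) auto
    with 2 have "(\<Sum>l<N + 2. border_lower N \<xi> n l * scaled_walk N \<xi> 0 p l) =
        (\<Sum>l<N + 2. if l = k then scaled_walk N \<xi> 0 p l else 0)"
      by (intro sum.cong) (auto simp: border_lower_def)
    with 2 k Suc show ?thesis by simp
  next
    case 3
    then have "(\<Sum>l<N + 2. border_lower N \<xi> n l * scaled_walk N \<xi> 0 p l) =
        (\<Sum>l<N + 2. if l = p then (if p \<le> N then \<xi> p else 0) else 0)"
      by (intro sum.cong) (auto simp: border_lower_def Suc)
    with 3 show ?thesis by simp
  qed (simp_all add: border_lower_def)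
  then show ?case
    by (simp add: scaled_walk_def lower del: sum.lessThan_Suc add_2_eq_Suc add_2_eq_Suc')
qed (auto simp: scaled_walk_def)

section \<open>Bounds for walks and the limit as the edge weight tends to 0\<close>

lemma continuous_scaled_walk [continuous_intros]: "isCont (\<lambda>\<delta>. scaled_walk N \<xi> \<delta> p n) x"
  by (induction p arbitrary: n) (auto simp: scaled_walk_def border_scaled_def intro!: continuous_intros)

lemma continuous_walk_gap: "isCont (walk_gap N \<xi> k) x"
  unfolding walk_gap_def[abs_def] by (intro continuous_intros)

lemma border_path_bound:
  assumes "0 < \<delta>" "\<delta> \<le> 1"
  shows "\<bar>border_path N \<xi> \<delta> n l\<bar> \<le> \<delta> * (1 + (\<Sum>l\<le>N. \<bar>\<xi> l\<bar>))"
proof -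
  let ?K = "1 + (\<Sum>l\<le>N. \<bar>\<xi> l\<bar>)"
  have K: "?K \<ge> 1" by (simp add: sum_nonneg)
  have lower: "\<bar>border_lower N \<xi> n l\<bar> \<le> ?K" for n l
    using K member_le_sum[of l "{..N}" "\<lambda>l. \<bar>\<xi> l\<bar>"] by (auto simp: border_lower_def sum_nonneg)
  have pow: "\<delta> ^ k \<le> \<delta>" if "k \<noteq> 0" for k
    using that assms power_le_one[of \<delta> "k - 1"] by (cases k) (auto simp: mult_left_le)
  have "\<bar>\<delta> ^ (n - l) * border_lower N \<xi> n l\<bar> \<le> \<delta> * ?K" if "n > l" for n l
    using that lower[of n l] pow[of "n - l"] assms
    by (auto simp: abs_mult intro!: mult_mono)
  then show ?thesis
    using assms K by (cases n l rule: linorder_cases) (auto simp: border_path_def border_lower_eq_0)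
qed

text \<open>\<open>C * \<delta>\<close> bounds the absolute row sums of \<open>border_path\<close>,
  since each nonzero entry carries a factor \<open>\<delta>\<close>.\<close>

lemma path_walk_bound:
  assumes \<delta>: "0 < \<delta>" "\<delta> \<le> 1" and C: "C = real (N + 2) * (1 + (\<Sum>l\<le>N. \<bar>\<xi> l\<bar>))"
  shows "\<bar>path_walk N \<xi> \<delta> p n\<bar> \<le> (C * \<delta>) ^ p"
proof (induction p arbitrary: n)
  case (Suc p)
  let ?K = "1 + (\<Sum>l\<le>N. \<bar>\<xi> l\<bar>)"
  have "0 \<le> \<delta> * ?K" using \<delta> by (simp add: sum_nonneg)
  have "\<bar>path_walk N \<xi> \<delta> (Suc p) n\<bar> \<le> (\<Sum>l<N + 2. \<delta> * ?K * (C * \<delta>) ^ p)"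
    unfolding path_walk_def mat_iter.simps
    using Suc border_path_bound[OF \<delta>] \<open>0 \<le> \<delta> * ?K\<close> unfolding path_walk_def
    by (intro order_trans[OF sum_abs] sum_mono) (auto simp only: abs_mult intro!: mult_mono)
  also have "\<dots> = (C * \<delta>) ^ Suc p"
    unfolding sum_constant by (simp add: C)
  finally show ?case .
qed (simp add: path_walk_def)


lemma suminf_walk_gap_at_0:
  fixes c :: "nat \<Rightarrow> complex"
  shows "suminf (\<lambda>k. c k * complex_of_real (walk_gap N \<xi> k 0)) =
    (\<Sum>i\<le>N. \<Sum>j\<le>N. c (i + j + 2) * complex_of_real (\<xi> i * \<xi> j))"
    (is "_ = ?R")
proof -
  \<comment> \<open>\<open>u p\<close> is the weight of reaching the border vertex in p steps,
    through p - 1; \<open>v q\<close> is that of the edge to q followed by q steps down. Both have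
    finite support, which cuts the series at k = 2N + 2.\<close>
  define u where "u p = (if 1 \<le> p \<and> p \<le> Suc N then \<xi> (p - 1) else 0)" for p
  define v where "v q = (if q \<le> N then \<xi> q else 0)" for q
  have gap: "walk_gap N \<xi> k 0 = (\<Sum>p<k. u p * v (k - 1 - p))" for k
  proof -
    have "(\<Sum>l\<le>N. \<xi> l * scaled_walk N (\<lambda>_. 0) 0 q l) = v q" for q
    proof -
      have "(\<Sum>l\<le>N. \<xi> l * scaled_walk N (\<lambda>_. 0) 0 q l) = (\<Sum>l\<le>N. if l = q then \<xi> l else 0)"
        by (intro sum.cong) (auto simp: scaled_walk_at_0)
      then show ?thesis by (simp add: v_def)
    qed
    then show ?thesis by (simp add: walk_gap_def u_def scaled_walk_at_0)
  qed
  have Suc_Suc: "Suc 0 \<le> p \<Longrightarrow> p < k \<Longrightarrow> Suc (Suc (k - 2)) = k" for k p :: nat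
    by arith
  let ?K = "{..2 * N + 2}" and ?S = "SIGMA k:{..2 * N + 2}. {..<k}"
  let ?t = "\<lambda>(k, p). c k * complex_of_real (u p * v (k - 1 - p))"
  have "suminf (\<lambda>k. c k * complex_of_real (walk_gap N \<xi> k 0)) = (\<Sum>k\<in>?K. c k * complex_of_real (walk_gap N \<xi> k 0))"
    by (rule suminf_finite) (auto simp: gap u_def v_def intro!: sum.neutral)
  also have "\<dots> = (\<Sum>(k, p)\<in>?S. c k * complex_of_real (u p * v (k - 1 - p)))"
    unfolding gap of_real_sum sum_distrib_left by (rule sum.Sigma) auto
  also have "\<dots> = sum ?t (?S - {x \<in> ?S. ?t x = 0})"
    by (rule sum.mono_neutral_right) auto
  \<comment> \<open>The surviving terms are p = i + 1 steps up, one step to j and j steps down, so k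
    = i + j + 2.\<close>
  also have "\<dots> = (\<Sum>(i, j)\<in>{..N} \<times> {..N}. c (i + j + 2) * complex_of_real (\<xi> i * \<xi> j))"
    by (rule sum.reindex_bij_witness_not_neutral[
        where S' = "{}" and T' = "{x \<in> {..N} \<times> {..N}. (\<lambda>(i, j). c (i + j + 2) * complex_of_real (\<xi> i * \<xi> j)) x = 0}"
          and i = "\<lambda>(i, j). (i + j + 2, i + 1)" and j = "\<lambda>(k, p). (p - 1, k - 1 - p)"])
      (auto simp: u_def v_def split: if_splits, (metis Suc_Suc)+)
  also have "\<dots> = ?R" by (simp add: sum.cartesian_product)
  finally show ?thesis .
qed

text \<open>Tannery's theorem. Divided by \<open>\<delta>^(2N+2)\<close>, the bound
  \<open>2 * (C * \<delta>) ^ k\<close> is still monotone in \<open>\<delta>\<close> once k \<ge> 2N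
  + 2, so its value at \<open>\<delta>0\<close> dominates; the finitely many smaller k need no
  common bound.\<close>

lemma walk_gap_tendsto:
  fixes c :: "nat \<Rightarrow> complex"
  assumes \<rho>: "\<rho> > 0" "summable (\<lambda>n. cmod (c n) * \<rho> ^ n)"
  shows "((\<lambda>\<delta>. suminf (\<lambda>k. c k * complex_of_real (walk_gap N \<xi> k \<delta>))) \<longlongrightarrow>
    (\<Sum>i\<le>N. \<Sum>j\<le>N. c (i + j + 2) * complex_of_real (\<xi> i * \<xi> j))) (at_right 0)"
proof -
  define C where "C = real (N + 2) * (1 + (\<Sum>l\<le>N. \<bar>\<xi> l\<bar>))"
  have C: "C > 0" by (simp add: C_def sum_nonneg add_pos_nonneg)
  have C0: "real (N + 2) * (1 + (\<Sum>l\<le>N. \<bar>0 :: real\<bar>)) \<le> C"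
    unfolding C_def by (intro mult_left_mono) (auto simp: sum_nonneg)
  \<comment> \<open>\<open>\<rho> / C\<close> makes the dominating series comparable with the given
    one at \<open>\<rho>\<close>; the cap 1 serves \<open>path_walk_bound\<close>.\<close>
  define \<delta>0 where "\<delta>0 = min 1 (\<rho> / C)"
  have \<delta>0: "\<delta>0 > 0" "\<delta>0 \<le> 1" "C * \<delta>0 \<le> \<rho>"
    using \<rho> C by (auto simp: \<delta>0_def min_def field_simps)
  let ?M = "\<lambda>k. 2 / \<delta>0 ^ (2 * N + 2) * (cmod (c k) * \<rho> ^ k)"
  have bound: "norm (c k * complex_of_real (walk_gap N \<xi> k \<delta>)) \<le> ?M k"
    if k: "k \<ge> 2 * N + 2" and \<delta>: "0 < \<delta>" "\<delta> \<le> \<delta>0" for k \<delta>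
  proof -
    let ?m = "2 * N + 2"
    have "\<bar>path_walk N \<xi> \<delta> k 0\<bar> \<le> (C * \<delta>) ^ k"
      using \<delta> \<delta>0 by (intro path_walk_bound) (auto simp: C_def)
    moreover have "\<bar>path_walk N (\<lambda>_. 0) \<delta> k 0\<bar> \<le> (C * \<delta>) ^ k"
      using \<delta> \<delta>0 C0
      by (intro order_trans[OF path_walk_bound[OF _ _ refl]] power_mono mult_right_mono) auto
    ultimately have "\<bar>\<delta> ^ ?m * walk_gap N \<xi> k \<delta>\<bar> \<le> 2 * (C * \<delta>) ^ k"
      unfolding path_walk_diff[symmetric] by linarith
    also have "\<dots> = 2 * C ^ k * (\<delta> ^ ?m * \<delta> ^ (k - ?m))"
      using k by (metis le_add_diff_inverse mult.assoc power_add power_mult_distrib)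
    also have "\<dots> \<le> 2 * C ^ k * (\<delta> ^ ?m * \<delta>0 ^ (k - ?m))"
      using C \<delta> by (intro mult_left_mono power_mono) auto
    also have "\<dots> = \<delta> ^ ?m * (2 * C ^ k * \<delta>0 ^ (k - ?m))" by simp
    finally have "\<bar>walk_gap N \<xi> k \<delta>\<bar> \<le> 2 * C ^ k * \<delta>0 ^ (k - ?m)"
      using \<delta> by (simp add: abs_mult)
    also have "\<dots> = 2 / \<delta>0 ^ ?m * (C * \<delta>0) ^ k"
      using k \<delta>0 by (simp add: power_mult_distrib power_diff)
    also have "\<dots> \<le> 2 / \<delta>0 ^ ?m * \<rho> ^ k"
      using \<delta>0 C by (intro mult_left_mono power_mono) auto
    finally have "cmod (c k) * \<bar>walk_gap N \<xi> k \<delta>\<bar> \<le> cmod (c k) * (2 / \<delta>0 ^ ?m * \<rho> ^ k)"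
      by (intro mult_left_mono) auto
    then show ?thesis by (simp add: norm_mult mult_ac)
  qed
  have "((\<lambda>\<delta>. suminf (\<lambda>k. c k * complex_of_real (walk_gap N \<xi> k \<delta>))) \<longlongrightarrow>
      suminf (\<lambda>k. c k * complex_of_real (walk_gap N \<xi> k 0))) (at_right 0)"
  proof (rule tannerys_theorem[THEN conjunct2, THEN conjunct2])
    show "((\<lambda>\<delta>. c k * complex_of_real (walk_gap N \<xi> k \<delta>)) \<longlongrightarrow>
        c k * complex_of_real (walk_gap N \<xi> k 0)) (at_right 0)" for k
      using continuous_walk_gap[where N = N and \<xi> = \<xi> and k = k and x = 0]
      by (intro tendsto_intros) (auto simp: isCont_def intro: tendsto_mono[OF at_le])
    have "eventually (\<lambda>\<delta>. 0 < \<delta> \<and> \<delta> \<le> \<delta>0) (at_right (0 :: real))"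
      using \<delta>0 by (auto simp: eventually_at_right_field intro!: exI[of _ \<delta>0])
    from eventually_conj[OF eventually_compose_filterlim[OF eventually_ge_at_top[of "2 * N + 2"] filterlim_fst]
        eventually_compose_filterlim[OF this filterlim_snd]]
    have "\<forall>\<^sub>F x in at_top \<times>\<^sub>F at_right (0 :: real). 2 * N + 2 \<le> fst x \<and> (0 < snd x \<and> snd x \<le> \<delta>0)" .
    then show "\<forall>\<^sub>F (k, \<delta>) in at_top \<times>\<^sub>F at_right 0.
        norm (c k * complex_of_real (walk_gap N \<xi> k \<delta>)) \<le> ?M k"
      by eventually_elim (use bound in auto)
    show "summable ?M" using \<rho>(2) by (rule summable_mult)
  qed simp
  then show ?thesis by (simp only: suminf_walk_gap_at_0)
qed

text \<open>The midpoint inequality is divided by \<open>\<delta>^(2N+2)\<close> before the limit.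
  The limiting form is even in \<open>\<xi>\<close>, so each sign contributes it once. Real and
  imaginary parts pass to the limit separately.\<close>

lemma walk_convex_imp_hankel_nonneg:
  fixes c :: "nat \<Rightarrow> complex"
  assumes \<rho>: "\<rho> > 0" "summable (\<lambda>n. cmod (c n) * \<rho> ^ n)"
    and convex: "\<forall>\<^sub>F \<delta> in at_right 0. \<exists>s0 s1 s2.
      (\<lambda>n. c n * complex_of_real (path_walk N (\<lambda>_. 0) \<delta> n 0)) sums s0 \<and>
      (\<lambda>n. c n * complex_of_real (path_walk N \<xi> \<delta> n 0)) sums s1 \<and>
      (\<lambda>n. c n * complex_of_real (path_walk N (\<lambda>i. - \<xi> i) \<delta> n 0)) sums s2 \<and> 0 \<le> s1 + s2 - 2 * s0"
  shows "0 \<le> (\<Sum>i\<le>N. \<Sum>j\<le>N. c (i + j + 2) * complex_of_real (\<xi> i * \<xi> j))"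
    (is "0 \<le> ?Q")
proof -
  let ?g = "\<lambda>\<xi> \<delta>. suminf (\<lambda>k. c k * complex_of_real (walk_gap N \<xi> k \<delta>))"
  have lim: "((\<lambda>\<delta>. ?g \<xi> \<delta> + ?g (\<lambda>i. - \<xi> i) \<delta>) \<longlongrightarrow> 2 * ?Q) (at_right 0)"
    using tendsto_add[OF walk_gap_tendsto[OF \<rho>, of N \<xi>] walk_gap_tendsto[OF \<rho>, of N "\<lambda>i. - \<xi> i"]]
    by simp
  have ev: "\<forall>\<^sub>F \<delta> in at_right 0. 0 \<le> ?g \<xi> \<delta> + ?g (\<lambda>i. - \<xi> i) \<delta>"
    using convex eventually_at_right_less[of "0 :: real"]
  proof eventually_elim
    case (elim \<delta>)
    then obtain s0 s1 s2 where s: "(\<lambda>n. c n * complex_of_real (path_walk N (\<lambda>_. 0) \<delta> n 0)) sums s0"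
      "(\<lambda>n. c n * complex_of_real (path_walk N \<xi> \<delta> n 0)) sums s1"
      "(\<lambda>n. c n * complex_of_real (path_walk N (\<lambda>i. - \<xi> i) \<delta> n 0)) sums s2"
      "0 \<le> s1 + s2 - 2 * s0"
      by blast
    define d where "d = complex_of_real (1 / \<delta> ^ (2 * N + 2))"
    have g: "?g \<eta> \<delta> = d * (s' - s0)"
      if "(\<lambda>n. c n * complex_of_real (path_walk N \<eta> \<delta> n 0)) sums s'" for \<eta> s'
    proof -
      have "c n * complex_of_real (walk_gap N \<eta> n \<delta>) = d * (c n * complex_of_real (path_walk N \<eta> \<delta> n 0)
          - c n * complex_of_real (path_walk N (\<lambda>_. 0) \<delta> n 0))" for n
        using path_walk_diff[of N \<eta> \<delta> n] elim
        by (simp add: d_def flip: right_diff_distrib of_real_diff)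
      then show ?thesis
        using sums_mult[OF sums_diff[OF that s(1)], of d] by (simp add: sums_iff)
    qed
    have "?g \<xi> \<delta> + ?g (\<lambda>i. - \<xi> i) \<delta> = d * (s1 + s2 - 2 * s0)"
      unfolding g[OF s(2)] g[OF s(3)] by (simp add: algebra_simps)
    also have "\<dots> \<ge> 0"
      using s(4) elim by (intro mult_nonneg_nonneg) (auto simp: d_def less_eq_complex_def simp del: of_real_divide of_real_power)
    finally show ?case .
  qed
  have "0 \<le> Re (2 * ?Q)"
    using ev by (intro tendsto_lowerbound[OF tendsto_Re[OF lim]])
      (auto simp: less_eq_complex_def elim!: eventually_mono)
  moreover have "Im (2 * ?Q) = 0"
  proof (rule tendsto_unique[OF _ tendsto_Im[OF lim]])
    show "((\<lambda>\<delta>. Im (?g \<xi> \<delta> + ?g (\<lambda>i. - \<xi> i) \<delta>)) \<longlongrightarrow> 0) (at_right 0)"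
      using ev by (intro tendsto_eventually) (auto simp: less_eq_complex_def elim!: eventually_mono)
  qed simp
  ultimately show ?thesis by (simp add: less_eq_complex_def)
qed

section \<open>Evaluation at Kronecker products\<close>

lemma sum_lessThan_mult:
  fixes f :: "nat \<Rightarrow> 'b :: comm_monoid_add"
  shows "(\<Sum>t<k * m. f t) = (\<Sum>a<m. \<Sum>b<k. f (k * a + b))"
proof -
  have "(\<Sum>t<k * m. f t) = (\<Sum>a<m. sum f {a * k..<a * k + k})"
    by (simp add: sum.nat_group mult.commute)
  also have "\<dots> = (\<Sum>a<m. \<Sum>b<k. f (k * a + b))"
  proof (rule sum.cong[OF refl])
    fix a
    show "sum f {a * k..<a * k + k} = (\<Sum>b<k. f (k * a + b))"
      using sum.shift_bounds_nat_ivl[of f 0 "a * k" k]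
      by (simp add: lessThan_atLeast0 add.commute mult.commute)
  qed
  finally show ?thesis .
qed

text \<open>T is the outer factor, so that the identity T gives the block diagonal matrices of
  \<open>tuple_ampl\<close>.\<close>

definition kron :: "nat \<Rightarrow> nat \<Rightarrow> (nat \<Rightarrow> nat \<Rightarrow> real) \<Rightarrow> complex mat \<Rightarrow> complex mat" where
  "kron k m T M = mat (k * m) (k * m)
     (\<lambda>(r, s). complex_of_real (T (r div k) (s div k)) * M $$ (r mod k, s mod k))"

lemma kron_carrier [simp]: "kron k m T M \<in> carrier_mat (k * m) (k * m)"
  by (simp add: kron_def)

lemma mod_less_of_less_mult: "r < k * m \<Longrightarrow> r mod k < (k :: nat)"
  by (cases k) auto

lemma herm_index:
  assumes "herm n M" "r < n" "s < n"
  shows "cnj (M $$ (s, r)) = M $$ (r, s)"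
  using index_mat_adjoint[of r M s] assms
  by (metis carrier_matD conjugate_complex_def herm_def)

lemma hermI:
  assumes "M \<in> carrier_mat n n" "\<And>r s. r < n \<Longrightarrow> s < n \<Longrightarrow> cnj (M $$ (s, r)) = M $$ (r, s)"
  shows "herm n M"
  unfolding herm_def using assms by (intro conjI eq_matI) auto

lemma herm_kron:
  assumes "herm k M" "\<And>a b. T a b = T b a"
  shows "herm (k * m) (kron k m T M)"
  using assms mod_less_of_less_mult[of _ k m]
  by (intro hermI kron_carrier) (simp add: kron_def herm_index)

lemma kron_midpoint:
  assumes "M \<in> carrier_mat k k" "\<And>a b. T a b = (T1 a b + T2 a b) / 2"
  shows "complex_of_real (1/2) \<cdot>\<^sub>m kron k m T1 M + complex_of_real (1 - 1/2) \<cdot>\<^sub>m kron k m T2 M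
    = kron k m T M"
  by (rule eq_matI) (simp_all add: kron_def assms(2) algebra_simps add_divide_distrib)

lemma diag_block_replicate_carrier:
  assumes "M \<in> carrier_mat k k"
  shows "diag_block_mat (replicate m M) \<in> carrier_mat (k * m) (k * m)"
  using assms by (induction m) (auto simp: Let_def)

lemma tuple_ampl_tuples: "A \<in> tuples k \<Longrightarrow> tuple_ampl m A \<in> tuples (k * m)"
  by (auto simp: tuples_def tuple_ampl_def intro: diag_block_replicate_carrier)

lemma diag_block_replicate:
  assumes "M \<in> carrier_mat k k"
  shows "diag_block_mat (replicate m M) = kron k m (\<lambda>a b. if a = b then 1 else 0) M"
proof (induction m)
  case (Suc m)
  have c: "diag_block_mat (replicate m M) \<in> carrier_mat (k * m) (k * m)"
    by (rule diag_block_replicate_carrier[OF assms])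
  show ?case
  proof (rule eq_matI)
    fix r s assume "r < dim_row (kron k (Suc m) (\<lambda>a b. if a = b then 1 else 0) M)"
      "s < dim_col (kron k (Suc m) (\<lambda>a b. if a = b then 1 else 0) M)"
    then have rs: "r < k + k * m" "s < k + k * m" by (auto simp: kron_def)
    then have k: "k > 0" by (cases k) auto
    have div_mod: "t div k = Suc ((t - k) div k)" "(t - k) mod k = t mod k" if "\<not> t < k" for t
      using that k by (auto simp: le_div_geq le_mod_geq)
    show "diag_block_mat (replicate (Suc m) M) $$ (r, s) =
        kron k (Suc m) (\<lambda>a b. if a = b then 1 else 0) M $$ (r, s)"
      using rs c assms
      by (cases "r < k"; cases "s < k") (auto simp: Let_def Suc kron_def div_mod)
  qed (use diag_block_replicate_carrier[OF assms, of "Suc m"] in \<open>auto simp: kron_def\<close>)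
qed (auto simp: kron_def)

text \<open>Only the first block column of a product is needed: it determines the entries seen by \<open>e\<^sub>0\<close>.\<close>
lemma kron_mult_index:
  assumes M: "M \<in> carrier_mat k k" and E: "E \<in> carrier_mat (k * m) (k * m)" and e: "e \<in> carrier_mat k k"
    and r: "r < k * m" and s: "s < k" and m: "m > 0"
    and col: "\<And>t. t < k * m \<Longrightarrow> E $$ (t, s) = complex_of_real (x (t div k)) * e $$ (t mod k, s)"
  shows "(kron k m T M * E) $$ (r, s) =
    complex_of_real (\<Sum>a<m. T (r div k) a * x a) * (M * e) $$ (r mod k, s)"
proof -
  have k: "k > 0" using s by simp
  have s': "s < k * m" using s m by (metis k less_le_trans mult.commute mult_le_mono1 nat_mult_1 Suc_leI One_nat_def)
  have rk: "r mod k < k" using k by simp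
  have idx: "k * a + b < k * m" if "a < m" "b < k" for a b
  proof -
    have "k * a + b < k * Suc a" using that by simp
    also have "\<dots> \<le> k * m" using that by (intro mult_le_mono2) simp
    finally show ?thesis .
  qed
  have "(kron k m T M * E) $$ (r, s) = (\<Sum>t<k * m. kron k m T M $$ (r, t) * E $$ (t, s))"
    using r s' E by (simp add: scalar_prod_def lessThan_atLeast0 kron_def)
  also have "\<dots> = (\<Sum>a<m. \<Sum>b<k. kron k m T M $$ (r, k * a + b) * E $$ (k * a + b, s))"
    by (rule sum_lessThan_mult)
  also have "\<dots> = (\<Sum>a<m. \<Sum>b<k. complex_of_real (T (r div k) a * x a) * (M $$ (r mod k, b) * e $$ (b, s)))"
    using r idx k by (intro sum.cong refl) (simp add: col kron_def)
  also have "\<dots> = complex_of_real (\<Sum>a<m. T (r div k) a * x a) * (\<Sum>b<k. M $$ (r mod k, b) * e $$ (b, s))"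
    by (simp only: of_real_sum sum_product)
  also have "(\<Sum>b<k. M $$ (r mod k, b) * e $$ (b, s)) = (M * e) $$ (r mod k, s)"
    using M e rk s by (simp add: scalar_prod_def lessThan_atLeast0)
  finally show ?thesis .
qed

lemma eval_word_Nil [simp]: "eval_word n Z [] = 1\<^sub>m n"
  and eval_word_Cons [simp]: "eval_word n Z (v # w) = Z v * eval_word n Z w"
  by (simp_all add: eval_word_def)

lemma eval_word_carrier:
  assumes "Z \<in> tuples n"
  shows "eval_word n Z w \<in> carrier_mat n n"
  using assms by (induction w) (auto simp: tuples_def)

text \<open>Each letter a acts as the identity tensored with A and each letter x as T tensored with
  H. The word thus becomes T^q tensored with the word at (A, H), q being its x-degree; in the first
  block column T enters only through T^q e_0, that is \<open>mat_iter\<close>.\<close>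

lemma eval_word_kron:
  fixes A :: "'a tuple" and H :: "'x tuple"
  assumes A: "A \<in> tuples k" and H: "H \<in> tuples k" and m: "m > 0"
    and "r < k * m" "s < k"
  shows "eval_word (k * m) (case_sum (tuple_ampl m A) (\<lambda>v. kron k m T (H v))) w $$ (r, s) =
    complex_of_real (mat_iter m T (x_degree w) (r div k)) * eval_word k (case_sum A H) w $$ (r mod k, s)"
  using assms(4)
proof (induction w arbitrary: r)
  case Nil
  have "s < k * m" using assms(5) m by (metis less_le_trans mult_le_mono2 nat_mult_1_right Suc_leI One_nat_def)
  moreover have "(r = s) = (r div k = 0 \<and> r mod k = s)"
    using assms(5) by (metis div_less mod_less div_eq_0_iff less_nat_zero_code)
  ultimately show ?case
    using Nil assms(5) by (auto simp: x_degree_def)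
next
  case (Cons v w)
  let ?Z = "case_sum (tuple_ampl m A) (\<lambda>v. kron k m T (H v))"
  have "?Z \<in> tuples (k * m)"
    using tuple_ampl_tuples[OF A, of m] by (auto simp: tuples_def split: sum.splits)
  then have E: "eval_word (k * m) ?Z w \<in> carrier_mat (k * m) (k * m)" by (rule eval_word_carrier)
  have "case_sum A H \<in> tuples k" using A H by (auto simp: tuples_def split: sum.splits)
  then have e: "eval_word k (case_sum A H) w \<in> carrier_mat k k" by (rule eval_word_carrier)
  have "r div k < m" using Cons.prems by (simp add: less_mult_imp_div_less mult.commute)
  show ?case
  proof (cases v)
    case (Inl a)
    have Aa: "A a \<in> carrier_mat k k" using A by (simp add: tuples_def)
    have Z: "?Z v = kron k m (\<lambda>a b. if a = b then 1 else 0) (A a)"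
      by (simp add: Inl tuple_ampl_def diag_block_replicate[OF Aa])
    have delta: "(\<Sum>b<m. (if r div k = b then 1 else 0) * mat_iter m T (x_degree w) b) =
        mat_iter m T (x_degree w) (r div k)"
    proof -
      have "(\<Sum>b<m. (if r div k = b then 1 else 0) * mat_iter m T (x_degree w) b) =
        (\<Sum>b<m. if r div k = b then mat_iter m T (x_degree w) b else 0)"
        by (intro sum.cong) auto
      then show ?thesis using \<open>r div k < m\<close> by simp
    qed
    have "eval_word (k * m) ?Z (v # w) $$ (r, s) =
        (kron k m (\<lambda>a b. if a = b then 1 else 0) (A a) * eval_word (k * m) ?Z w) $$ (r, s)"
      by (simp only: eval_word_Cons Z)
    also have "\<dots> = complex_of_real (\<Sum>b<m. (if r div k = b then 1 else 0) * mat_iter m T (x_degree w) b) *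
        (A a * eval_word k (case_sum A H) w) $$ (r mod k, s)"
      by (rule kron_mult_index[OF Aa E e Cons.prems assms(5) m Cons.IH])
    finally show ?thesis
      unfolding delta by (simp add: Inl x_degree_def)
  next
    case (Inr x)
    have "H x \<in> carrier_mat k k" using H by (simp add: tuples_def)
    then show ?thesis
      using kron_mult_index[OF _ E e Cons.prems assms(5) m Cons.IH]
      by (simp add: Inr x_degree_def)
  qed
qed

text \<open>By homogeneity all words carry the same factor, the (0, 0) entry of T^q. This is what
  reduces the x-power series to scalar series.\<close>

lemma eval_ncpoly_kron:
  fixes A :: "'a tuple" and H :: "'x tuple"
  assumes A: "A \<in> tuples k" and H: "H \<in> tuples k" and m: "m > 0"
    and p: "x_homogeneous q p" and r: "r < k" and s: "s < k"
  shows "eval_ncpoly (k * m) p (case_sum (tuple_ampl m A) (\<lambda>v. kron k m T (H v))) $$ (r, s) =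
    eval_ncpoly k p (case_sum A H) $$ (r, s) * complex_of_real (mat_iter m T q 0)"
proof -
  have le: "k \<le> k * m" using m by simp
  then have "r < k * m" "s < k * m" using r s by linarith+
  moreover from this have "eval_word (k * m) (case_sum (tuple_ampl m A) (\<lambda>v. kron k m T (H v))) w $$ (r, s) =
      complex_of_real (mat_iter m T q 0) * eval_word k (case_sum A H) w $$ (r, s)"
    if "w \<in> Poly_Mapping.keys p" for w
    using eval_word_kron[OF A H m, of r s T w] r s p that by (simp add: x_homogeneous_def)
  ultimately show ?thesis
    using r s by (simp add: eval_ncpoly_def sum_distrib_right sum_distrib_left mult_ac)
qed

lemma tuple_ampl_in_C_level:
  assumes "A \<in> tuples k"
  shows "tuple_ampl m A \<in> C_level k A m"
proof -
  have "tuple_ampl m A = tuple_conj (1\<^sub>m (k * m)) (tuple_ampl m A)"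
  proof
    fix v
    have "tuple_ampl m A v \<in> carrier_mat (k * m) (k * m)"
      using tuple_ampl_tuples[OF assms] by (simp add: tuples_def)
    then show "tuple_ampl m A v = tuple_conj (1\<^sub>m (k * m)) (tuple_ampl m A) v"
      by (simp add: tuple_conj_def)
  qed
  then show ?thesis
    unfolding C_level_def using unitary_one by blast
qed

lemma tuple_ampl_1: "A \<in> tuples k \<Longrightarrow> tuple_ampl 1 A = A"
  by (auto simp: tuple_ampl_def tuples_def fun_eq_iff Let_def intro!: eq_matI)

text \<open>Scaling is the Kronecker product with the 1 x 1 matrix (t).\<close>

lemma eval_ncpoly_smult:
  fixes A :: "'a tuple" and H :: "'x tuple"
  assumes A: "A \<in> tuples k" and H: "H \<in> tuples k" and p: "x_homogeneous q p" and "r < k" "s < k"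
  shows "eval_ncpoly k p (case_sum A (\<lambda>v. complex_of_real t \<cdot>\<^sub>m H v)) $$ (r, s) =
    eval_ncpoly k p (case_sum A H) $$ (r, s) * complex_of_real t ^ q"
proof -
  have "kron k 1 (\<lambda>_ _. t) (H v) = complex_of_real t \<cdot>\<^sub>m H v" for v
  proof -
    have "H v \<in> carrier_mat k k" using H by (simp add: tuples_def)
    then show ?thesis by (intro eq_matI) (auto simp: kron_def)
  qed
  moreover have "mat_iter 1 (\<lambda>_ _. t) q 0 = t ^ q" by (induction q) auto
  ultimately show ?thesis
    using eval_ncpoly_kron[OF A H _ p assms(4,5), of 1 "\<lambda>_ _. t"] tuple_ampl_1[OF A]
    by simp
qed

lemma eval_ncpoly_add:
  assumes "k < n" "l < n"
  shows "eval_ncpoly n (p + q) Z $$ (k, l) = eval_ncpoly n p Z $$ (k, l) + eval_ncpoly n q Z $$ (k, l)"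
proof -
  let ?K = "Poly_Mapping.keys p \<union> Poly_Mapping.keys q"
  \<comment> \<open>Words may cancel in \<open>p + q\<close>, so all three sums are taken over the
    union of keys.\<close>
  have extend: "eval_ncpoly n f Z $$ (k, l) =
      (\<Sum>w\<in>?K. Poly_Mapping.lookup f w * eval_word n Z w $$ (k, l))"
    if "Poly_Mapping.keys f \<subseteq> ?K" for f
    unfolding eval_ncpoly_def using assms that
    by (simp, intro sum.mono_neutral_left) (auto simp: in_keys_iff)
  show ?thesis
    by (simp add: extend keys_add lookup_add sum.distrib distrib_right)
qed

lemma x_degree_le_add:
  "x_degree_le n p \<Longrightarrow> x_degree_le n q \<Longrightarrow> x_degree_le n (p + q)"
  using keys_add[of p q] by (auto simp: x_degree_le_def)

section \<open>Restriction to lines and quadratic forms\<close>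

lemma smult_tuples [simp]:
  "X \<in> tuples n \<Longrightarrow> (\<lambda>v. c \<cdot>\<^sub>m X v) \<in> tuples n"
  by (simp add: tuples_def)

lemma herm_tuples_subset_tuples: "herm_tuples n \<subseteq> tuples n"
  by (auto simp: herm_tuples_def tuples_def herm_def)

lemma herm_tuples_smult_real:
  assumes "X \<in> herm_tuples n"
  shows "(\<lambda>v. complex_of_real t \<cdot>\<^sub>m X v) \<in> herm_tuples n"
  unfolding herm_tuples_def
proof (intro CollectI allI hermI)
  fix v
  have X: "herm n (X v)" using assms by (simp add: herm_tuples_def)
  then have Xc: "X v \<in> carrier_mat n n" by (simp add: herm_def)
  then show "complex_of_real t \<cdot>\<^sub>m X v \<in> carrier_mat n n" by simp
  fix r s assume "r < n" "s < n"
  then show "cnj ((complex_of_real t \<cdot>\<^sub>m X v) $$ (s, r)) = (complex_of_real t \<cdot>\<^sub>m X v) $$ (r, s)"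
    using Xc by (simp add: herm_index[OF X])
qed

lemma tuple_entries_bounded:
  fixes X :: "('v :: finite) tuple"
  obtains b where "b \<ge> 0" "\<And>v k l. k < n \<Longrightarrow> l < n \<Longrightarrow> cmod (X v $$ (k, l)) \<le> b"
proof -
  define b where "b = (\<Sum>v\<in>UNIV. \<Sum>k<n. \<Sum>l<n. cmod (X v $$ (k, l)))"
  have "cmod (X v $$ (k, l)) \<le> b" if "k < n" "l < n" for v k l
  proof -
    have "cmod (X v $$ (k, l)) \<le> (\<Sum>l<n. cmod (X v $$ (k, l)))"
      using that by (intro member_le_sum) auto
    also have "\<dots> \<le> (\<Sum>k<n. \<Sum>l<n. cmod (X v $$ (k, l)))"
      using that by (intro member_le_sum[of k]) (auto intro!: sum_nonneg)
    also have "\<dots> \<le> b"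
      unfolding b_def by (intro member_le_sum[of v]) (auto intro!: sum_nonneg)
    finally show ?thesis .
  qed
  moreover have "b \<ge> 0" by (auto simp: b_def intro!: sum_nonneg)
  ultimately show thesis using that by blast
qed

lemma tuple_norm_smult_bounded:
  fixes X :: "('v :: finite) tuple"
  assumes X: "X \<in> tuples n" and n: "n \<ge> 1"
  obtains K where "K > 0" "\<And>c. tuple_norm n (\<lambda>v. c \<cdot>\<^sub>m X v) \<le> K * cmod c"
proof -
  obtain b where "b \<ge> 0" and b: "\<And>v k l. k < n \<Longrightarrow> l < n \<Longrightarrow> cmod (X v $$ (k, l)) \<le> b"
    using tuple_entries_bounded[of n X] by blast
  \<comment> \<open>The summand 1 keeps K positive when b = 0; later arguments divide by K.\<close>
  let ?K = "real n * real (card (UNIV :: 'v set)) * b + 1"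
  have "tuple_norm n (\<lambda>v. c \<cdot>\<^sub>m X v) \<le> ?K * cmod c" for c
  proof -
    have "cmod ((c \<cdot>\<^sub>m X v) $$ (k, l)) \<le> cmod c * b" if "k < n" "l < n" for v k l
    proof -
      have "X v \<in> carrier_mat n n" using X by (simp add: tuples_def)
      then show ?thesis using that b[OF that] by (simp add: norm_mult mult_left_mono)
    qed
    then have "tuple_norm n (\<lambda>v. c \<cdot>\<^sub>m X v) \<le> real n * real (card (UNIV :: 'v set)) * (cmod c * b)"
      using X n by (intro tuple_norm_le) auto
    also have "\<dots> \<le> ?K * cmod c" by (simp add: algebra_simps)
    finally show ?thesis .
  qed
  moreover have "?K > 0" using \<open>b \<ge> 0\<close> by (simp add: add_nonneg_pos)
  ultimately show thesis using that by blast
qed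

text \<open>Chain rule: the total derivative at y H is applied to the increment (z - y) H, whose
  norm is at most K |z - y|. Radii and error bounds are divided by K accordingly.\<close>

lemma analytic_along_line:
  fixes H :: "('v :: finite) tuple"
  assumes W: "open_tuples n W" and f: "analytic_on_tuples n W f" and H: "H \<in> tuples n" and n: "n \<ge> 1"
  shows "open {z. (\<lambda>v. z \<cdot>\<^sub>m H v) \<in> W}"
    and "(\<lambda>z. f (\<lambda>v. z \<cdot>\<^sub>m H v)) holomorphic_on {z. (\<lambda>v. z \<cdot>\<^sub>m H v) \<in> W}"
proof -
  obtain K where K: "K > 0" "\<And>c. tuple_norm n (\<lambda>v. c \<cdot>\<^sub>m H v) \<le> K * cmod c"
    using tuple_norm_smult_bounded[OF H n] by blast
  have Hc: "H v \<in> carrier_mat n n" for v using H by (simp add: tuples_def)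
  have diff: "(\<lambda>v. z \<cdot>\<^sub>m H v - y \<cdot>\<^sub>m H v) = (\<lambda>v. (z - y) \<cdot>\<^sub>m H v)" for z y
    using Hc by (intro ext eq_matI) (auto simp: left_diff_distrib)
  have add: "(\<lambda>v. y \<cdot>\<^sub>m H v + (z - y) \<cdot>\<^sub>m H v) = (\<lambda>v. z \<cdot>\<^sub>m H v)" for z y
    using Hc by (intro ext eq_matI) (auto simp: left_diff_distrib)
  show op: "open {z. (\<lambda>v. z \<cdot>\<^sub>m H v) \<in> W}"
    unfolding open_dist
  proof safe
    fix y assume "(\<lambda>v. y \<cdot>\<^sub>m H v) \<in> W"
    then obtain \<delta> where \<delta>: "\<delta> > 0"
      "\<And>Y. Y \<in> tuples n \<Longrightarrow> tuple_norm n (\<lambda>v. Y v - y \<cdot>\<^sub>m H v) < \<delta> \<Longrightarrow> Y \<in> W"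
      using W unfolding open_tuples_def by meson
    have "(\<lambda>v. z \<cdot>\<^sub>m H v) \<in> W" if "dist z y < \<delta> / K" for z
    proof (rule \<delta>(2))
      have "tuple_norm n (\<lambda>v. z \<cdot>\<^sub>m H v - y \<cdot>\<^sub>m H v) \<le> K * cmod (z - y)"
        unfolding diff by (rule K(2))
      also have "\<dots> < \<delta>" using that K(1) by (simp add: dist_norm field_simps)
      finally show "tuple_norm n (\<lambda>v. z \<cdot>\<^sub>m H v - y \<cdot>\<^sub>m H v) < \<delta>" .
    qed (use H in simp)
    then show "\<exists>e>0. \<forall>z. dist z y < e \<longrightarrow> z \<in> {z. (\<lambda>v. z \<cdot>\<^sub>m H v) \<in> W}"
      using \<delta>(1) K(1) by (intro exI[of _ "\<delta> / K"]) auto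
  qed
  have "\<exists>L. ((\<lambda>z. f (\<lambda>v. z \<cdot>\<^sub>m H v)) has_field_derivative L) (at y)"
    if y: "(\<lambda>v. y \<cdot>\<^sub>m H v) \<in> W" for y
  proof -
    obtain c where c: "\<And>e. e > 0 \<Longrightarrow> \<exists>\<delta>>0. \<forall>D \<in> tuples n. tuple_norm n D < \<delta> \<longrightarrow>
        cmod (f (\<lambda>v. y \<cdot>\<^sub>m H v + D v) - f (\<lambda>v. y \<cdot>\<^sub>m H v) - (\<Sum>v\<in>UNIV. \<Sum>k<n. \<Sum>l<n. c v k l * D v $$ (k, l)))
          \<le> e * tuple_norm n D"
      using f y unfolding analytic_on_tuples_def by meson
    define L where "L = (\<Sum>v\<in>UNIV. \<Sum>k<n. \<Sum>l<n. c v k l * H v $$ (k, l))"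
    have lin: "(\<Sum>v\<in>UNIV. \<Sum>k<n. \<Sum>l<n. c v k l * (z \<cdot>\<^sub>m H v) $$ (k, l)) = L * z" for z
    proof -
      have dims: "dim_row (H v) = n" "dim_col (H v) = n" for v using Hc[of v] by auto
      show ?thesis by (simp add: L_def sum_distrib_left dims mult_ac)
    qed
    have "((\<lambda>z. f (\<lambda>v. z \<cdot>\<^sub>m H v)) has_derivative (*) L) (at y)"
      unfolding has_derivative_at_alt
    proof (intro conjI allI impI)
      show "bounded_linear ((*) L)" by (rule bounded_linear_mult_right)
      fix e :: real assume "e > 0"
      then obtain \<delta> where \<delta>: "\<delta> > 0" "\<And>D. D \<in> tuples n \<Longrightarrow> tuple_norm n D < \<delta> \<Longrightarrow>
        cmod (f (\<lambda>v. y \<cdot>\<^sub>m H v + D v) - f (\<lambda>v. y \<cdot>\<^sub>m H v) - (\<Sum>v\<in>UNIV. \<Sum>k<n. \<Sum>l<n. c v k l * D v $$ (k, l)))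
          \<le> e / K * tuple_norm n D"
        using c[of "e / K"] K(1) by auto
      have "cmod (f (\<lambda>v. z \<cdot>\<^sub>m H v) - f (\<lambda>v. y \<cdot>\<^sub>m H v) - L * (z - y)) \<le> e * cmod (z - y)"
        if "cmod (z - y) < \<delta> / K" for z
      proof -
        have "tuple_norm n (\<lambda>v. (z - y) \<cdot>\<^sub>m H v) \<le> K * cmod (z - y)" by (rule K(2))
        moreover from this have "tuple_norm n (\<lambda>v. (z - y) \<cdot>\<^sub>m H v) < \<delta>"
          using that K(1) by (simp add: field_simps)
        then have "cmod (f (\<lambda>v. z \<cdot>\<^sub>m H v) - f (\<lambda>v. y \<cdot>\<^sub>m H v) - L * (z - y))
            \<le> e / K * tuple_norm n (\<lambda>v. (z - y) \<cdot>\<^sub>m H v)"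
          using \<delta>(2)[of "\<lambda>v. (z - y) \<cdot>\<^sub>m H v"] H by (simp only: add lin smult_tuples)
        moreover have "e / K \<ge> 0" using \<open>e > 0\<close> K(1) by simp
        ultimately have "cmod (f (\<lambda>v. z \<cdot>\<^sub>m H v) - f (\<lambda>v. y \<cdot>\<^sub>m H v) - L * (z - y))
            \<le> e / K * (K * cmod (z - y))"
          by (meson mult_left_mono order_trans)
        then show ?thesis using K(1) by simp
      qed
      then show "\<exists>d>0. \<forall>z. norm (z - y) < d \<longrightarrow>
          norm (f (\<lambda>v. z \<cdot>\<^sub>m H v) - f (\<lambda>v. y \<cdot>\<^sub>m H v) - L * (z - y)) \<le> e * norm (z - y)"
        using \<delta>(1) K(1) by (intro exI[of _ "\<delta> / K"]) auto
    qed
    then show ?thesis by (auto simp: has_field_derivative_def)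
  qed
  then show "(\<lambda>z. f (\<lambda>v. z \<cdot>\<^sub>m H v)) holomorphic_on {z. (\<lambda>v. z \<cdot>\<^sub>m H v) \<in> W}"
    using op by (auto simp: holomorphic_on_open)
qed

text \<open>The form w^* B w of a block matrix, with block index \<open>a div k\<close> and inner
  index \<open>a mod k\<close>. Blocks may be larger than k x k; only their upper left corners are
  read.\<close>

definition weighted_form ::
  "nat \<Rightarrow> nat \<Rightarrow> (nat \<Rightarrow> complex) \<Rightarrow> complex mat matrix_of \<Rightarrow> complex" where
  "weighted_form d k w B = (\<Sum>a<d * k. \<Sum>b<d * k. cnj (w a) * w b * B (a div k) (b div k) $$ (a mod k, b mod k))"

text \<open>Polarization: basis vectors give the diagonal; on two indices, the coefficients (1, 1)
  and (1, \<i>) give the sum and the difference of the two mirrored entries.\<close>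

lemma weighted_form_eq_0_imp:
  assumes "\<And>w. weighted_form d k w B = 0" "i < d" "j < d" "r < k" "s < k"
  shows "B i j $$ (r, s) = 0"
proof -
  define M where "M a b = B (a div k) (b div k) $$ (a mod k, b mod k)" for a b
  define a b where "a = k * i + r" and "b = k * j + s"
  have less: "k * i + r < d * k" if "i < d" "r < k" for i r
  proof -
    have "k * i + r < k * Suc i" using that by simp
    also have "\<dots> \<le> k * d" using that by (intro mult_le_mono2) simp
    finally show ?thesis by (simp add: mult.commute)
  qed
  have ab: "a < d * k" "b < d * k" using assms less by (auto simp: a_def b_def)
  have form: "cnj x * x * M a' a' + cnj x * y * M a' b' + (cnj y * x * M b' a' + cnj y * y * M b' b') = 0"
    if "a' < d * k" "b' < d * k" "a' \<noteq> b'" for x y a' b'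
  proof -
    define w where "w t = (if t = a' then x else if t = b' then y else 0)" for t
    have restrict: "(\<Sum>t<d * k. g t) = g a' + g b'" if "\<And>t. w t = 0 \<Longrightarrow> g t = 0" for g :: "nat \<Rightarrow> complex"
    proof -
      have "(\<Sum>t<d * k. g t) = (\<Sum>t\<in>{a', b'}. g t)"
        using \<open>a' < d * k\<close> \<open>b' < d * k\<close> that
        by (intro sum.mono_neutral_right) (auto simp: w_def)
      with \<open>a' \<noteq> b'\<close> show ?thesis by simp
    qed
    have "weighted_form d k w B = (\<Sum>t<d * k. \<Sum>u<d * k. cnj (w t) * w u * M t u)"
      by (simp add: weighted_form_def M_def)
    also have "\<dots> = (\<Sum>u<d * k. cnj (w a') * w u * M a' u) + (\<Sum>u<d * k. cnj (w b') * w u * M b' u)"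
      by (rule restrict) simp
    also have "\<dots> = (cnj (w a') * w a' * M a' a' + cnj (w a') * w b' * M a' b')
        + (cnj (w b') * w a' * M b' a' + cnj (w b') * w b' * M b' b')"
      by (intro arg_cong2[of _ _ _ _ "(+)"] restrict) auto
    finally show ?thesis using assms(1)[of w] that by (simp add: w_def)
  qed
  have diag: "M t t = 0" if "t < d * k" for t
  proof -
    define w where "w u = (if u = t then 1 else 0 :: complex)" for u
    have "(\<Sum>b<d * k. cnj (w a) * w b * M a b) = (if a = t then M t t else 0)" for a
    proof (cases "a = t")
      case True
      then have "(\<Sum>b<d * k. cnj (w a) * w b * M a b) = (\<Sum>b<d * k. if b = t then M t t else 0)"
        by (intro sum.cong) (auto simp: w_def)
      with True that show ?thesis by simp
    qed (simp add: w_def)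
    then have "weighted_form d k w B = (\<Sum>a<d * k. if a = t then M t t else 0)"
      by (simp add: weighted_form_def M_def)
    then show ?thesis using assms(1)[of w] that by simp
  qed
  have "M a b = 0"
  proof (cases "a = b")
    case False
    have "M a b + M b a = 0" "M a b - M b a = 0"
      using form[OF ab False, of 1 1] form[OF ab False, of 1 \<i>] diag ab
      by (auto simp: algebra_simps)
    then show ?thesis by (simp add: eq_neg_iff_add_eq_0)
  qed (use diag ab in auto)
  then show ?thesis
    using assms by (simp add: M_def a_def b_def)
qed

text \<open>The vector \<open>e\<^sub>0 \<otimes> w\<close>, in the index order of \<open>block_mat\<close>.\<close>
definition block_vec :: "nat \<Rightarrow> nat \<Rightarrow> nat \<Rightarrow> (nat \<Rightarrow> complex) \<Rightarrow> complex Matrix.vec" where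
  "block_vec d k n w = Matrix.vec (d * n) (\<lambda>u. if u mod n < k then w (k * (u div n) + u mod n) else 0)"

text \<open>\<open>block_vec\<close> is supported on the first k places of each of the d blocks, so
  a form at the large size reads exactly the corners that \<open>eval_ncpoly_kron\<close>
  computes.\<close>

lemma block_vec_form:
  assumes "k \<le> n"
  shows "(block_mat d n B *\<^sub>v block_vec d k n w) \<bullet>c block_vec d k n w = weighted_form d k w B"
proof -
  have sum_blocks: "(\<Sum>u<d * n. if u mod n < k then g (u div n) (u mod n) else 0)
      = (\<Sum>a<d * k. g (a div k) (a mod k))" for g :: "nat \<Rightarrow> nat \<Rightarrow> complex"
  proof -
    have "(\<Sum>u<n * d. if u mod n < k then g (u div n) (u mod n) else 0)
        = (\<Sum>i<d. \<Sum>r<n. if r < k then g i r else 0)"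
      unfolding sum_lessThan_mult by (intro sum.cong refl) auto
    also have "\<dots> = (\<Sum>i<d. \<Sum>r<k. g i r)"
      using assms by (intro sum.cong refl sum.mono_neutral_cong_right) auto
    also have "\<dots> = (\<Sum>a<k * d. g (a div k) (a mod k))"
      unfolding sum_lessThan_mult by (intro sum.cong refl) auto
    finally show ?thesis by (simp add: mult.commute)
  qed
  let ?v = "\<lambda>u. if u mod n < k then w (k * (u div n) + u mod n) else 0"
  have kd: "k * (a div k) + a mod k = a" for a by simp
  have "(block_mat d n B *\<^sub>v block_vec d k n w) \<bullet>c block_vec d k n w
    = (\<Sum>u<d * n. (\<Sum>t<d * n. B (u div n) (t div n) $$ (u mod n, t mod n) * ?v t) * cnj (?v u))"
    by (simp add: block_mat_def block_vec_def scalar_prod_def lessThan_atLeast0)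
  also have "\<dots> = (\<Sum>u<d * n. if u mod n < k then
      (\<Sum>t<d * n. if t mod n < k then
        cnj (w (k * (u div n) + u mod n)) * w (k * (t div n) + t mod n) * B (u div n) (t div n) $$ (u mod n, t mod n)
        else 0) else 0)"
    by (intro sum.cong refl) (auto simp: sum_distrib_right intro!: sum.cong)
  also have "\<dots> = (\<Sum>u<d * n. if u mod n < k then
      (\<Sum>b<d * k. cnj (w (k * (u div n) + u mod n)) * w b * B (u div n) (b div k) $$ (u mod n, b mod k)) else 0)"
  proof (rule sum.cong[OF refl], rule if_cong[OF refl _ refl])
    fix u
    show "(\<Sum>t<d * n. if t mod n < k then
        cnj (w (k * (u div n) + u mod n)) * w (k * (t div n) + t mod n) * B (u div n) (t div n) $$ (u mod n, t mod n)
        else 0) =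
      (\<Sum>b<d * k. cnj (w (k * (u div n) + u mod n)) * w b * B (u div n) (b div k) $$ (u mod n, b mod k))"
      using sum_blocks[of "\<lambda>i r. cnj (w (k * (u div n) + u mod n)) * w (k * i + r) * B (u div n) i $$ (u mod n, r)"]
      by (simp only: kd)
  qed
  also have "\<dots> = weighted_form d k w B"
    using sum_blocks[of "\<lambda>i r. \<Sum>b<d * k. cnj (w (k * i + r)) * w b * B i (b div k) $$ (r, b mod k)"]
    by (simp only: kd weighted_form_def)
  finally show ?thesis .
qed

lemma weighted_form_sums:
  assumes "\<And>i j r s. i < d \<Longrightarrow> j < d \<Longrightarrow> r < k \<Longrightarrow> s < k \<Longrightarrow>
    (\<lambda>p. C p i j $$ (r, s) * x p) sums (B i j $$ (r, s))"
  shows "(\<lambda>p. weighted_form d k w (C p) * x p) sums weighted_form d k w B"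
proof -
  have "(\<lambda>p. \<Sum>a<d * k. \<Sum>b<d * k. cnj (w a) * w b * (C p (a div k) (b div k) $$ (a mod k, b mod k) * x p))
      sums (\<Sum>a<d * k. \<Sum>b<d * k. cnj (w a) * w b * B (a div k) (b div k) $$ (a mod k, b mod k))"
    by (intro sums_sum sums_mult assms)
      (use mod_less_of_less_mult[of _ k d, unfolded mult.commute[of k d]] in \<open>auto simp: less_mult_imp_div_less\<close>)
  then show ?thesis by (simp add: weighted_form_def sum_distrib_right mult.assoc)
qed

section \<open>Functions on the real line with a holomorphic extension\<close>

definition real_entire :: "(real \<Rightarrow> complex) \<Rightarrow> bool" where
  "real_entire f \<longleftrightarrow> (\<exists>S h. open S \<and> range complex_of_real \<subseteq> S \<and> h holomorphic_on S \<and>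
     (\<forall>t. h (complex_of_real t) = f t))"

lemma real_entireI:
  "open S \<Longrightarrow> range complex_of_real \<subseteq> S \<Longrightarrow> h holomorphic_on S \<Longrightarrow>
    (\<And>t. h (complex_of_real t) = f t) \<Longrightarrow> real_entire f"
  unfolding real_entire_def by blast

lemma real_entire_add:
  assumes "real_entire f" "real_entire g"
  shows "real_entire (\<lambda>t. f t + g t)"
proof -
  obtain S h where f: "open S" "range complex_of_real \<subseteq> S" "h holomorphic_on S"
    "\<And>t. h (complex_of_real t) = f t"
    using assms(1) unfolding real_entire_def by blast
  obtain T k where g: "open T" "range complex_of_real \<subseteq> T" "k holomorphic_on T"
    "\<And>t. k (complex_of_real t) = g t"
    using assms(2) unfolding real_entire_def by blast
  have "(\<lambda>z. h z + k z) holomorphic_on (S \<inter> T)"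
    using f(3) g(3) by (intro holomorphic_intros) (auto intro: holomorphic_on_subset)
  then show ?thesis
    by (rule real_entireI[of "S \<inter> T", rotated 2]) (use f g in auto)
qed

lemma real_entire_cmult:
  assumes "real_entire f"
  shows "real_entire (\<lambda>t. c * f t)"
proof -
  obtain S h where f: "open S" "range complex_of_real \<subseteq> S" "h holomorphic_on S"
    "\<And>t. h (complex_of_real t) = f t"
    using assms unfolding real_entire_def by blast
  then have "(\<lambda>z. c * h z) holomorphic_on S" by (intro holomorphic_intros)
  then show ?thesis
    by (rule real_entireI[rotated 2]) (use f in auto)
qed

lemma real_entire_power: "real_entire (\<lambda>t. complex_of_real t ^ n)"
  by (rule real_entireI[of UNIV "\<lambda>z. z ^ n"]) (auto intro!: holomorphic_intros)

lemma real_entire_sum: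
  assumes "\<And>a. a \<in> I \<Longrightarrow> real_entire (f a)"
  shows "real_entire (\<lambda>t. \<Sum>a\<in>I. f a t)"
  using assms
proof (induction I rule: infinite_finite_induct)
  case (insert a I)
  then show ?case by (simp add: real_entire_add)
qed (use real_entire_cmult[OF real_entire_power[of 0], of 0] in auto)

text \<open>Identity theorem on the component of the domain that contains the real line; the domain
  itself may be disconnected.\<close>

lemma real_entire_eq_0:
  assumes "real_entire f" and \<epsilon>: "\<epsilon> > 0" and zero: "\<And>t. \<bar>t\<bar> < \<epsilon> \<Longrightarrow> f t = 0"
  shows "f t = 0"
proof -
  obtain S h where h: "open S" "range complex_of_real \<subseteq> S" "h holomorphic_on S"
    "\<And>t. h (complex_of_real t) = f t"
    using assms unfolding real_entire_def by blast
  let ?C = "connected_component_set S 0"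
  let ?U = "complex_of_real ` {0<..<\<epsilon>}"
  have "connected (range complex_of_real)"
    by (intro connected_continuous_image continuous_intros) auto
  moreover have "0 \<in> range complex_of_real" by (metis of_real_0 rangeI)
  ultimately have real: "range complex_of_real \<subseteq> ?C"
    using h(2) by (intro connected_component_maximal) auto
  have "h (complex_of_real t) = 0"
  proof (rule analytic_continuation[of h ?C ?U 0])
    show "h holomorphic_on ?C"
      using h(3) by (rule holomorphic_on_subset) (rule connected_component_subset)
    show "0 islimpt ?U"
      unfolding islimpt_approachable
    proof safe
      fix e :: real assume "e > 0"
      then show "\<exists>x'\<in>?U. x' \<noteq> 0 \<and> dist x' 0 < e"
        using \<epsilon> by (intro bexI[OF _ imageI[of "min e \<epsilon> / 2"]]) (auto simp: dist_norm)
    qed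
    show "0 \<in> ?C" using real by (metis of_real_0 rangeI subsetD)
    show "?U \<subseteq> ?C" "complex_of_real t \<in> ?C" using real by blast+
  qed (use h real zero in \<open>auto simp: open_connected_component\<close>)
  then show ?thesis by (simp add: h(4))
qed

section \<open>Scalar consequences of the hypotheses at one set (C_A, 0)\<close>

lemma uniform_radius:
  fixes N :: "'b \<Rightarrow> real"
  assumes "finite I" "\<And>x. x \<in> I \<Longrightarrow> \<exists>\<epsilon>>0. \<forall>y. N y < \<epsilon> \<longrightarrow> Q x y"
  shows "\<exists>\<epsilon>>0. \<forall>x\<in>I. \<forall>y. N y < \<epsilon> \<longrightarrow> Q x y"
  using assms
proof (induction I rule: finite_induct)
  case (insert a I)
  obtain \<epsilon>1 where "\<epsilon>1 > 0" "\<forall>x\<in>I. \<forall>y. N y < \<epsilon>1 \<longrightarrow> Q x y" using insert by auto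
  moreover obtain \<epsilon>2 where "\<epsilon>2 > 0" "\<forall>y. N y < \<epsilon>2 \<longrightarrow> Q a y" using insert.prems[of a] by blast
  ultimately show ?case by (intro exI[of _ "min \<epsilon>1 \<epsilon>2"]) auto
qed (auto intro: exI[of _ 1])

text \<open>Each entry comes with its own radius, and the least of the d^2 radii serves all. The
  pair (m, X) is handled as one variable because the norm depends on the size.\<close>

lemma x_real_entire_at_series:
  assumes "x_real_entire_at d F S \<kappa> A"
  obtains \<epsilon> where "\<epsilon> > 0"
    "\<And>m \<alpha> X i j k l. m \<ge> 1 \<Longrightarrow> \<alpha> \<in> C_level \<kappa> A m \<Longrightarrow> X \<in> herm_tuples (\<kappa> * m) \<Longrightarrow>
       tuple_norm (\<kappa> * m) X < \<epsilon> \<Longrightarrow> i < d \<Longrightarrow> j < d \<Longrightarrow> k < \<kappa> * m \<Longrightarrow> l < \<kappa> * m \<Longrightarrow>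
       (\<lambda>p. eval_ncpoly (\<kappa> * m) (S p i j) (case_sum \<alpha> X) $$ (k, l)) sums (F i j (case_sum \<alpha> X) $$ (k, l))"
proof -
  let ?N = "\<lambda>(m, X). tuple_norm (\<kappa> * m) X"
  let ?Q = "\<lambda>(i, j) (m, X). 1 \<le> m \<longrightarrow> X \<in> herm_tuples (\<kappa> * m) \<longrightarrow> (\<forall>\<alpha>\<in>C_level \<kappa> A m. \<forall>k<\<kappa> * m. \<forall>l<\<kappa> * m.
      (\<lambda>p. eval_ncpoly (\<kappa> * m) (S p i j) (case_sum \<alpha> X) $$ (k, l)) sums (F i j (case_sum \<alpha> X) $$ (k, l)))"
  have "\<exists>\<epsilon>>0. \<forall>y. ?N y < \<epsilon> \<longrightarrow> ?Q x y" if mem: "x \<in> {..<d} \<times> {..<d}" for x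
  proof -
    obtain i j where x: "x = (i, j)" "i < d" "j < d" using mem by auto
    then have "entry_x_real_entire_at (F i j) (\<lambda>k. S k i j) \<kappa> A"
      using assms by (simp add: x_real_entire_at_def)
    then obtain \<epsilon> where "\<epsilon> > 0" "\<forall>m\<ge>1. \<forall>\<alpha> \<in> C_level \<kappa> A m.
        \<forall>X \<in> herm_tuples (\<kappa> * m). tuple_norm (\<kappa> * m) X < \<epsilon> \<longrightarrow>
          (\<forall>k < \<kappa> * m. \<forall>l < \<kappa> * m.
             (\<lambda>p. eval_ncpoly (\<kappa> * m) (S p i j) (case_sum \<alpha> X) $$ (k, l))
               sums (F i j (case_sum \<alpha> X) $$ (k, l)))"
      unfolding entry_x_real_entire_at_def by blast
    then show ?thesis using x by (intro exI[of _ \<epsilon>]) auto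
  qed
  then have "\<exists>\<epsilon>>0. \<forall>x\<in>{..<d} \<times> {..<d}. \<forall>y. ?N y < \<epsilon> \<longrightarrow> ?Q x y"
    by (intro uniform_radius) auto
  then obtain \<epsilon> where "\<epsilon> > 0" "\<forall>x\<in>{..<d} \<times> {..<d}. \<forall>y. ?N y < \<epsilon> \<longrightarrow> ?Q x y" by blast
  then show thesis by (intro that[of \<epsilon>]) auto
qed

text \<open>The case m = 1 along the line t H. For real t this tuple is Hermitian, so the real axis
  lies in the domain of the continuation.\<close>

lemma x_real_entire_at_real_entire:
  assumes "x_real_entire_at d F S \<kappa> A" and \<kappa>: "\<kappa> \<ge> 1" and A: "A \<in> tuples \<kappa>" and H: "H \<in> herm_tuples \<kappa>"
    and ij: "i < d" "j < d" and rs: "r < \<kappa>" "s < \<kappa>"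
  shows "real_entire (\<lambda>t. F i j (case_sum A (\<lambda>v. complex_of_real t \<cdot>\<^sub>m H v)) $$ (r, s))"
proof -
  have "entry_x_real_entire_at (F i j) (\<lambda>k. S k i j) \<kappa> A"
    using assms(1) ij by (simp add: x_real_entire_at_def)
  moreover have "A \<in> C_level \<kappa> A 1"
    using tuple_ampl_in_C_level[OF A, of 1] tuple_ampl_1[OF A] by simp
  ultimately obtain W G where W: "open_tuples \<kappa> W" "herm_tuples \<kappa> \<subseteq> W"
    "\<forall>k < \<kappa>. \<forall>l < \<kappa>. analytic_on_tuples \<kappa> W (\<lambda>X. G X $$ (k, l))"
    "\<forall>X \<in> herm_tuples \<kappa>. G X = F i j (case_sum A X)"
    unfolding entry_x_real_entire_at_def by (metis le_refl mult.right_neutral)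
  have H': "H \<in> tuples \<kappa>" using H herm_tuples_subset_tuples by blast
  have "analytic_on_tuples \<kappa> W (\<lambda>X. G X $$ (r, s))" using W(3) rs by blast
  note line = analytic_along_line[OF W(1) this H' \<kappa>]
  show ?thesis
    using W(2,4) herm_tuples_smult_real[OF H] by (intro real_entireI[OF line(1) _ line(2)]) auto
qed

lemma border_path_0_midpoint:
  "border_path N (\<lambda>_. 0) \<delta> a b = (border_path N \<xi> \<delta> a b + border_path N (\<lambda>i. - \<xi> i) \<delta> a b) / 2"
  by (simp add: border_path_def border_lower_def)

text \<open>For fixed N and H all entries are of order \<open>\<delta>\<close>; hence series and
  convexity are both available for small \<open>\<delta>\<close>.\<close>

lemma kron_border_path_norm_small:
  fixes H :: "('x :: finite) tuple"
  assumes H: "H \<in> tuples \<kappa>" and \<kappa>: "\<kappa> \<ge> 1" and \<epsilon>: "\<epsilon> > 0"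
  shows "\<forall>\<^sub>F \<delta> in at_right 0. tuple_norm (\<kappa> * (N + 2)) (\<lambda>v. kron \<kappa> (N + 2) (border_path N \<xi> \<delta>) (H v)) < \<epsilon>"
proof -
  obtain b where b: "b \<ge> 0" "\<And>v k l. k < \<kappa> \<Longrightarrow> l < \<kappa> \<Longrightarrow> cmod (H v $$ (k, l)) \<le> b"
    using tuple_entries_bounded[of \<kappa> H] by blast
  define K where "K = 1 + (\<Sum>l\<le>N. \<bar>\<xi> l\<bar>)"
  have K: "K > 0" by (simp add: K_def sum_nonneg add_pos_nonneg)
  define C where "C = real (\<kappa> * (N + 2)) * real (card (UNIV :: 'x set)) * (K * b)"
  have "((\<lambda>\<delta>. C * \<delta>) \<longlongrightarrow> C * 0) (at_right 0)"
    by (intro tendsto_intros)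
  then have "\<forall>\<^sub>F \<delta> in at_right 0. C * \<delta> < \<epsilon>"
    using \<epsilon> by (intro order_tendstoD(2)) auto
  moreover have "\<forall>\<^sub>F \<delta> in at_right (0 :: real). 0 < \<delta> \<and> \<delta> \<le> 1"
    by (auto simp: eventually_at_right_field intro!: exI[of _ 1])
  ultimately show ?thesis
  proof eventually_elim
    case (elim \<delta>)
    have "tuple_norm (\<kappa> * (N + 2)) (\<lambda>v. kron \<kappa> (N + 2) (border_path N \<xi> \<delta>) (H v))
        \<le> real (\<kappa> * (N + 2)) * real (card (UNIV :: 'x set)) * (\<delta> * K * b)"
    proof (rule tuple_norm_le)
      fix v r s assume rs: "r < \<kappa> * (N + 2)" "s < \<kappa> * (N + 2)"
      have "\<bar>border_path N \<xi> \<delta> (r div \<kappa>) (s div \<kappa>)\<bar> \<le> \<delta> * K"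
        unfolding K_def using elim by (intro border_path_bound) auto
      moreover have "cmod (H v $$ (r mod \<kappa>, s mod \<kappa>)) \<le> b"
        using b(2) \<kappa> by simp
      ultimately show "cmod (kron \<kappa> (N + 2) (border_path N \<xi> \<delta>) (H v) $$ (r, s)) \<le> \<delta> * K * b"
        using rs elim K by (auto simp: kron_def norm_mult intro!: mult_mono)
    qed (use \<kappa> in \<open>auto simp: tuples_def simp del: add_2_eq_Suc' mult_Suc_right\<close>)
    also have "\<dots> = C * \<delta>" by (simp add: C_def)
    also have "\<dots> < \<epsilon>" using elim by simp
    finally show ?case .
  qed
qed

lemma loewner_le_midpoint_form:
  assumes le: "loewner_le n E0 (a \<cdot>\<^sub>m E1 + b \<cdot>\<^sub>m E2)"
    and E: "E0 \<in> carrier_mat n n" "E1 \<in> carrier_mat n n" "E2 \<in> carrier_mat n n" and v: "v \<in> carrier_vec n"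
  shows "0 \<le> a * ((E1 *\<^sub>v v) \<bullet>c v) + b * ((E2 *\<^sub>v v) \<bullet>c v) - (E0 *\<^sub>v v) \<bullet>c v"
proof -
  have form: "(M *\<^sub>v v) \<bullet>c v = (\<Sum>i<n. \<Sum>j<n. M $$ (i, j) * v $ j * cnj (v $ i))"
    if "M \<in> carrier_mat n n" for M
    using that v by (simp add: scalar_prod_def lessThan_atLeast0 sum_distrib_right)
  have c: "a \<cdot>\<^sub>m E1 + b \<cdot>\<^sub>m E2 - E0 \<in> carrier_mat n n" by (rule minus_carrier_mat[OF E(1)])
  have "0 \<le> ((a \<cdot>\<^sub>m E1 + b \<cdot>\<^sub>m E2 - E0) *\<^sub>v v) \<bullet>c v"
    using le v by (simp add: loewner_le_def psd_def)
  also have "\<dots> = a * ((E1 *\<^sub>v v) \<bullet>c v) + b * ((E2 *\<^sub>v v) \<bullet>c v) - (E0 *\<^sub>v v) \<bullet>c v"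
    unfolding form[OF c] form[OF E(1)] form[OF E(2)] form[OF E(3)] sum_distrib_left
      sum.distrib[symmetric] sum_subtractf[symmetric]
    using E by (intro sum.cong refl) (simp add: algebra_simps)
  finally show ?thesis .
qed

lemma block_mat_carrier: "block_mat d n B \<in> carrier_mat (d * n) (d * n)"
  by (simp add: block_mat_def)

section \<open>One point A and one direction H: the coefficients of degree at least 3\<close>

context
  fixes F :: "(('a :: finite + 'x :: finite) tuple \<Rightarrow> complex mat) matrix_of"
    and S :: "nat \<Rightarrow> ('a + 'x) ncpoly matrix_of" and d \<kappa> :: nat
    and A :: "'a tuple" and H :: "'x tuple"
  assumes \<kappa>: "\<kappa> \<ge> 1" and A: "A \<in> tuples \<kappa>" and H: "H \<in> herm_tuples \<kappa>"
    and convex: "matrix_convex_in_x_at d F S \<kappa> A" and entire: "x_real_entire_at d F S \<kappa> A"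
begin

lemma line_series:
  obtains \<epsilon> where "\<epsilon> > 0" "\<And>t i j r s. \<bar>t\<bar> < \<epsilon> \<Longrightarrow> i < d \<Longrightarrow> j < d \<Longrightarrow> r < \<kappa> \<Longrightarrow> s < \<kappa> \<Longrightarrow>
    (\<lambda>p. eval_ncpoly \<kappa> (S p i j) (case_sum A H) $$ (r, s) * complex_of_real t ^ p) sums
      (F i j (case_sum A (\<lambda>v. complex_of_real t \<cdot>\<^sub>m H v)) $$ (r, s))"
proof -
  have H': "H \<in> tuples \<kappa>" using H herm_tuples_subset_tuples by blast
  have hom: "x_homogeneous p (S p i j)" if "i < d" "j < d" for p i j
    using entire that by (simp add: x_real_entire_at_def x_power_series_def)
  obtain \<epsilon> where \<epsilon>: "\<epsilon> > 0"
    "\<And>m \<alpha> X i j k l. m \<ge> 1 \<Longrightarrow> \<alpha> \<in> C_level \<kappa> A m \<Longrightarrow> X \<in> herm_tuples (\<kappa> * m) \<Longrightarrow>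
       tuple_norm (\<kappa> * m) X < \<epsilon> \<Longrightarrow> i < d \<Longrightarrow> j < d \<Longrightarrow> k < \<kappa> * m \<Longrightarrow> l < \<kappa> * m \<Longrightarrow>
       (\<lambda>p. eval_ncpoly (\<kappa> * m) (S p i j) (case_sum \<alpha> X) $$ (k, l)) sums (F i j (case_sum \<alpha> X) $$ (k, l))"
    using x_real_entire_at_series[OF entire] by blast
  obtain K where K: "K > 0" "\<And>c. tuple_norm \<kappa> (\<lambda>v. c \<cdot>\<^sub>m H v) \<le> K * cmod c"
    using tuple_norm_smult_bounded[OF H' \<kappa>] by blast
  have AC: "A \<in> C_level \<kappa> A 1"
    using tuple_ampl_in_C_level[OF A, of 1] tuple_ampl_1[OF A] by simp
  show thesis
  proof (rule that[of "\<epsilon> / K"])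
    fix t i j r s assume t: "\<bar>t\<bar> < \<epsilon> / K" and ij: "i < d" "j < d" and rs: "r < \<kappa>" "s < \<kappa>"
    have "tuple_norm \<kappa> (\<lambda>v. complex_of_real t \<cdot>\<^sub>m H v) \<le> K * \<bar>t\<bar>"
      using K(2)[of "complex_of_real t"] by simp
    also have "\<dots> < \<epsilon>" using t K(1) by (simp add: field_simps)
    finally have "(\<lambda>p. eval_ncpoly \<kappa> (S p i j) (case_sum A (\<lambda>v. complex_of_real t \<cdot>\<^sub>m H v)) $$ (r, s)) sums
      (F i j (case_sum A (\<lambda>v. complex_of_real t \<cdot>\<^sub>m H v)) $$ (r, s))"
      using \<epsilon>(2)[OF le_refl AC, of "\<lambda>v. complex_of_real t \<cdot>\<^sub>m H v" i j r s]
        herm_tuples_smult_real[OF H] ij rs by simp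
    then show "(\<lambda>p. eval_ncpoly \<kappa> (S p i j) (case_sum A H) $$ (r, s) * complex_of_real t ^ p) sums
      (F i j (case_sum A (\<lambda>v. complex_of_real t \<cdot>\<^sub>m H v)) $$ (r, s))"
      by (simp only: eval_ncpoly_smult[OF A H' hom[OF ij] rs])
  qed (use \<epsilon> K in simp)
qed

lemma coefficient_form_eq_0:
  assumes p: "p \<ge> 3"
  shows "weighted_form d \<kappa> w (\<lambda>i j. eval_ncpoly \<kappa> (S p i j) (case_sum A H)) = 0"
proof -
  define c where "c p = weighted_form d \<kappa> w (\<lambda>i j. eval_ncpoly \<kappa> (S p i j) (case_sum A H))" for p
  define f where "f t = weighted_form d \<kappa> w (\<lambda>i j. F i j (case_sum A (\<lambda>v. complex_of_real t \<cdot>\<^sub>m H v)))" for t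
  have H': "H \<in> tuples \<kappa>" using H herm_tuples_subset_tuples by blast
  have hom: "x_homogeneous p (S p i j)" if "i < d" "j < d" for p i j
    using entire that by (simp add: x_real_entire_at_def x_power_series_def)
  obtain r where r: "r > 0" and series: "\<And>t. \<bar>t\<bar> < r \<Longrightarrow> (\<lambda>p. c p * complex_of_real t ^ p) sums f t"
  proof -
    obtain \<epsilon> where \<epsilon>: "\<epsilon> > 0" "\<And>t i j r s. \<bar>t\<bar> < \<epsilon> \<Longrightarrow> i < d \<Longrightarrow> j < d \<Longrightarrow> r < \<kappa> \<Longrightarrow> s < \<kappa> \<Longrightarrow>
      (\<lambda>p. eval_ncpoly \<kappa> (S p i j) (case_sum A H) $$ (r, s) * complex_of_real t ^ p) sums
        (F i j (case_sum A (\<lambda>v. complex_of_real t \<cdot>\<^sub>m H v)) $$ (r, s))"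
      using line_series by blast
    have "(\<lambda>p. c p * complex_of_real t ^ p) sums f t" if "\<bar>t\<bar> < \<epsilon>" for t
      unfolding c_def f_def by (rule weighted_form_sums) (rule \<epsilon>(2)[OF that])
    with \<epsilon>(1) show thesis by (rule that)
  qed
  \<comment> \<open>Convergence at r/2 gives absolute convergence at r/4, which supplies the
    dominating series for the limit in \<open>\<delta>\<close>.\<close>
  have "summable (\<lambda>p. c p * complex_of_real (r / 2) ^ p)"
    using series[of "r / 2"] r by (simp add: sums_iff)
  then have "summable (\<lambda>p. cmod (c p * complex_of_real (r / 4) ^ p))"
    by (rule powser_insidea) (use r in simp)
  then have summable: "summable (\<lambda>p. cmod (c p) * (r / 4) ^ p)"
    using r by (simp add: norm_mult norm_power del: of_real_divide)
  obtain \<epsilon>1 where \<epsilon>1: "\<epsilon>1 > 0"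
    "\<And>m \<alpha> X i j k l. m \<ge> 1 \<Longrightarrow> \<alpha> \<in> C_level \<kappa> A m \<Longrightarrow> X \<in> herm_tuples (\<kappa> * m) \<Longrightarrow>
       tuple_norm (\<kappa> * m) X < \<epsilon>1 \<Longrightarrow> i < d \<Longrightarrow> j < d \<Longrightarrow> k < \<kappa> * m \<Longrightarrow> l < \<kappa> * m \<Longrightarrow>
       (\<lambda>p. eval_ncpoly (\<kappa> * m) (S p i j) (case_sum \<alpha> X) $$ (k, l)) sums (F i j (case_sum \<alpha> X) $$ (k, l))"
    using x_real_entire_at_series[OF entire] by blast
  obtain \<epsilon>2 where \<epsilon>2: "\<epsilon>2 > 0"
    "\<And>m \<alpha> X Y t. m \<ge> 1 \<Longrightarrow> \<alpha> \<in> C_level \<kappa> A m \<Longrightarrow>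
        X \<in> herm_tuples (\<kappa> * m) \<Longrightarrow> Y \<in> herm_tuples (\<kappa> * m) \<Longrightarrow> t \<in> {0..1 :: real} \<Longrightarrow>
          tuple_norm (\<kappa> * m) X < \<epsilon>2 \<Longrightarrow> tuple_norm (\<kappa> * m) Y < \<epsilon>2 \<Longrightarrow>
          loewner_le (d * (\<kappa> * m))
            (eval_fun_matrix d (\<kappa> * m) F (case_sum \<alpha>
               (\<lambda>v. complex_of_real t \<cdot>\<^sub>m X v + complex_of_real (1 - t) \<cdot>\<^sub>m Y v)))
            (complex_of_real t \<cdot>\<^sub>m eval_fun_matrix d (\<kappa> * m) F (case_sum \<alpha> X)
             + complex_of_real (1 - t) \<cdot>\<^sub>m eval_fun_matrix d (\<kappa> * m) F (case_sum \<alpha> Y))"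
    using convex unfolding matrix_convex_in_x_at_def by blast
  have hankel: "0 \<le> (\<Sum>i\<le>N. \<Sum>j\<le>N. c (i + j + 2) * complex_of_real (\<xi> i * \<xi> j))" for N \<xi>
  proof (rule walk_convex_imp_hankel_nonneg[OF _ summable])
    \<comment> \<open>One copy of A per vertex: N + 1 on the path and the border vertex. The radii
      \<open>\<epsilon>1\<close> and \<open>\<epsilon>2\<close> were fixed before N, thanks to
      uniformity in m.\<close>
    define m where "m = N + 2"
    have m: "m \<ge> 1" by (simp add: m_def)
    define \<alpha> where "\<alpha> = tuple_ampl m A"
    have \<alpha>: "\<alpha> \<in> C_level \<kappa> A m" unfolding \<alpha>_def by (rule tuple_ampl_in_C_level[OF A])
    define X where "X \<eta> \<delta> v = kron \<kappa> m (border_path N \<eta> \<delta>) (H v)" for \<eta> \<delta> v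
    have X: "X \<eta> \<delta> \<in> herm_tuples (\<kappa> * m)" for \<eta> \<delta>
      using H by (auto simp: herm_tuples_def X_def intro!: herm_kron border_path_sym)
    have small: "\<forall>\<^sub>F \<delta> in at_right 0. tuple_norm (\<kappa> * m) (X \<eta> \<delta>) < min \<epsilon>1 \<epsilon>2" for \<eta>
      unfolding X_def m_def using \<epsilon>1(1) \<epsilon>2(1) by (intro kron_border_path_norm_small[OF H' \<kappa>]) auto
    define s where "s \<eta> \<delta> = weighted_form d \<kappa> w (\<lambda>i j. F i j (case_sum \<alpha> (X \<eta> \<delta>)))" for \<eta> \<delta>
    have sums: "(\<lambda>p. c p * complex_of_real (path_walk N \<eta> \<delta> p 0)) sums s \<eta> \<delta>"
      if "tuple_norm (\<kappa> * m) (X \<eta> \<delta>) < min \<epsilon>1 \<epsilon>2" for \<eta> \<delta>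
      unfolding c_def s_def
    proof (rule weighted_form_sums)
      fix i j r s assume ij: "i < d" "j < d" and rs: "r < \<kappa>" "s < \<kappa>"
      have "\<kappa> \<le> \<kappa> * m" using m by simp
      then have "r < \<kappa> * m" "s < \<kappa> * m" using rs by linarith+
      then have "(\<lambda>p. eval_ncpoly (\<kappa> * m) (S p i j) (case_sum \<alpha> (X \<eta> \<delta>)) $$ (r, s))
          sums (F i j (case_sum \<alpha> (X \<eta> \<delta>)) $$ (r, s))"
        using that ij by (intro \<epsilon>1(2)[OF m \<alpha> X]) auto
      moreover have "eval_ncpoly (\<kappa> * m) (S p i j) (case_sum \<alpha> (X \<eta> \<delta>)) $$ (r, s) =
          eval_ncpoly \<kappa> (S p i j) (case_sum A H) $$ (r, s) * complex_of_real (path_walk N \<eta> \<delta> p 0)" for p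
        unfolding path_walk_def m_def[symmetric] \<alpha>_def X_def
        using m by (intro eval_ncpoly_kron[OF A H' _ hom[OF ij] rs]) simp
      ultimately show "(\<lambda>p. eval_ncpoly \<kappa> (S p i j) (case_sum A H) $$ (r, s) *
          complex_of_real (path_walk N \<eta> \<delta> p 0)) sums (F i j (case_sum \<alpha> (X \<eta> \<delta>)) $$ (r, s))"
        by (simp only:)
    qed
    have midpoint: "(\<lambda>v. complex_of_real (1/2) \<cdot>\<^sub>m X \<xi> \<delta> v + complex_of_real (1 - 1/2) \<cdot>\<^sub>m X (\<lambda>i. - \<xi> i) \<delta> v)
        = X (\<lambda>_. 0) \<delta>" for \<delta>
      unfolding X_def using H' border_path_0_midpoint
      by (intro ext kron_midpoint) (auto simp: tuples_def)
    show "\<forall>\<^sub>F \<delta> in at_right 0. \<exists>s0 s1 s2.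
      (\<lambda>n. c n * complex_of_real (path_walk N (\<lambda>_. 0) \<delta> n 0)) sums s0 \<and>
      (\<lambda>n. c n * complex_of_real (path_walk N \<xi> \<delta> n 0)) sums s1 \<and>
      (\<lambda>n. c n * complex_of_real (path_walk N (\<lambda>i. - \<xi> i) \<delta> n 0)) sums s2 \<and> 0 \<le> s1 + s2 - 2 * s0"
      using small[of "\<lambda>_. 0"] small[of \<xi>] small[of "\<lambda>i. - \<xi> i"]
    proof eventually_elim
      case (elim \<delta>)
      let ?E = "\<lambda>\<eta>. block_mat d (\<kappa> * m) (\<lambda>i j. F i j (case_sum \<alpha> (X \<eta> \<delta>)))"
      let ?v = "block_vec d \<kappa> (\<kappa> * m) w"
      \<comment> \<open>Convexity at t = 1/2 for the border weights \<open>\<xi>\<close> and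
        \<open>- \<xi>\<close>, whose midpoint is the path without border.\<close>
      have "loewner_le (d * (\<kappa> * m)) (?E (\<lambda>_. 0))
          (complex_of_real (1/2) \<cdot>\<^sub>m ?E \<xi> + complex_of_real (1 - 1/2) \<cdot>\<^sub>m ?E (\<lambda>i. - \<xi> i))"
        using \<epsilon>2(2)[OF m \<alpha> X[of \<xi> \<delta>] X[of "\<lambda>i. - \<xi> i" \<delta>], of "1/2"] elim
        unfolding midpoint eval_fun_matrix_def by simp
      then have "0 \<le> complex_of_real (1/2) * ((?E \<xi> *\<^sub>v ?v) \<bullet>c ?v) +
          complex_of_real (1 - 1/2) * ((?E (\<lambda>i. - \<xi> i) *\<^sub>v ?v) \<bullet>c ?v) - (?E (\<lambda>_. 0) *\<^sub>v ?v) \<bullet>c ?v"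
        by (rule loewner_le_midpoint_form[OF _ block_mat_carrier block_mat_carrier block_mat_carrier])
          (simp add: block_vec_def)
      also have "\<dots> = (s \<xi> \<delta> + s (\<lambda>i. - \<xi> i) \<delta> - 2 * s (\<lambda>_. 0) \<delta>) / 2"
        using m by (simp add: block_vec_form s_def field_simps)
      finally have "0 \<le> s \<xi> \<delta> + s (\<lambda>i. - \<xi> i) \<delta> - 2 * s (\<lambda>_. 0) \<delta>"
        by (simp add: less_eq_complex_def)
      with sums[OF elim(1)] sums[OF elim(2)] sums[OF elim(3)] show ?case by blast
    qed
  qed (use r in simp)
  have "real_entire f"
    unfolding f_def weighted_form_def
    using mod_less_of_less_mult[of _ \<kappa> d, unfolded mult.commute[of \<kappa> d]]
    by (intro real_entire_sum real_entire_cmult x_real_entire_at_real_entire[OF entire \<kappa> A H])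
      (auto simp: less_mult_imp_div_less)
  then obtain T h where h: "open T" "range complex_of_real \<subseteq> T" "h holomorphic_on T"
    "\<And>t. h (complex_of_real t) = f t"
    unfolding real_entire_def by blast
  have "c p = 0"
    using r series by (intro hankel_nonneg_entire_imp_zero[OF hankel h(1-3) _ _ p]) (auto simp: h(4))
  then show ?thesis by (simp add: c_def)
qed

lemma eq_quadratic_part:
  assumes ij: "i < d" "j < d" and rs: "r < \<kappa>" "s < \<kappa>"
  shows "F i j (case_sum A H) $$ (r, s) = (\<Sum>p<3. eval_ncpoly \<kappa> (S p i j) (case_sum A H) $$ (r, s))"
proof -
  let ?e = "\<lambda>p. eval_ncpoly \<kappa> (S p i j) (case_sum A H) $$ (r, s)"
  let ?f = "\<lambda>t. F i j (case_sum A (\<lambda>v. complex_of_real t \<cdot>\<^sub>m H v)) $$ (r, s)"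
  have vanish: "?e p = 0" if "p \<ge> 3" for p
    using weighted_form_eq_0_imp[OF coefficient_form_eq_0[OF that] ij rs] .
  obtain \<epsilon> where \<epsilon>: "\<epsilon> > 0" "\<And>t. \<bar>t\<bar> < \<epsilon> \<Longrightarrow> (\<lambda>p. ?e p * complex_of_real t ^ p) sums ?f t"
  proof (rule line_series)
    fix \<epsilon> :: real
    assume "\<epsilon> > 0" and series: "\<And>t i j r s. \<bar>t\<bar> < \<epsilon> \<Longrightarrow> i < d \<Longrightarrow> j < d \<Longrightarrow> r < \<kappa> \<Longrightarrow> s < \<kappa> \<Longrightarrow>
      (\<lambda>p. eval_ncpoly \<kappa> (S p i j) (case_sum A H) $$ (r, s) * complex_of_real t ^ p) sums
        (F i j (case_sum A (\<lambda>v. complex_of_real t \<cdot>\<^sub>m H v)) $$ (r, s))"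
    show thesis
      using \<open>\<epsilon> > 0\<close> series[OF _ ij rs] by (rule that)
  qed
  let ?g = "\<lambda>t. ?f t + (-1) * (\<Sum>p<3. ?e p * complex_of_real t ^ p)"
  \<comment> \<open>The difference vanishes for small t, hence on the whole line, and t = 1 is the
    tuple H itself, however large.\<close>
  have "?g 1 = 0"
  proof (rule real_entire_eq_0[OF _ \<epsilon>(1)])
    show "real_entire ?g"
      by (intro real_entire_add real_entire_cmult real_entire_sum real_entire_power
          x_real_entire_at_real_entire[OF entire \<kappa> A H ij rs])
    fix t :: real assume "\<bar>t\<bar> < \<epsilon>"
    then have "(\<lambda>p. ?e p * complex_of_real t ^ p) sums ?f t" by (rule \<epsilon>(2))
    moreover have "(\<lambda>p. ?e p * complex_of_real t ^ p) sums (\<Sum>p<3. ?e p * complex_of_real t ^ p)"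
      by (rule sums_finite) (auto simp: vanish)
    ultimately show "?g t = 0" using sums_unique2 by fastforce
  qed
  moreover have "(\<lambda>v. complex_of_real 1 \<cdot>\<^sub>m H v) = H" by (auto intro!: eq_matI)
  ultimately show ?thesis by simp
qed

end

theorem corollary1p6:
  fixes U :: "('a :: finite) tuple set"
    and F :: "(('a + 'x :: finite) tuple \<Rightarrow> complex mat) matrix_of"
    and S :: "nat \<Rightarrow> ('a + 'x) ncpoly matrix_of"
    and d :: nat
  assumes "d \<ge> 1"
    and "nc_set U" and "nc_open U"
    and "\<And>i j. i < d \<Longrightarrow> j < d \<Longrightarrow> nc_function all_herm_tuples (F i j)"
    and "\<And>n Z. n \<ge> 1 \<Longrightarrow> Z \<in> herm_tuples n \<Longrightarrow> herm (d * n) (eval_fun_matrix d n F Z)"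
    and "\<And>\<kappa> A. \<kappa> \<ge> 1 \<Longrightarrow> A \<in> U \<inter> herm_tuples \<kappa> \<Longrightarrow>
           matrix_convex_in_x_at d F S \<kappa> A \<and> x_real_entire_at d F S \<kappa> A"
  shows "\<exists>P :: ('a + 'x) ncpoly matrix_of.
           (\<forall>i<d. \<forall>j<d. x_degree_le 2 (P i j)) \<and>
           (\<forall>n\<ge>1. \<forall>A \<in> U \<inter> herm_tuples n. \<forall>X \<in> herm_tuples n. \<forall>i<d. \<forall>j<d.
              F i j (case_sum A X) = eval_ncpoly n (P i j) (case_sum A X))"
proof (cases "\<exists>n\<ge>1. U \<inter> herm_tuples n \<noteq> {}")
  case False
  \<comment> \<open>With no point in U the hypotheses give no information on \<open>S\<close>, and
    the claim on values is vacuous.\<close>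
  have "x_degree_le 2 (0 :: ('a + 'x) ncpoly)" by (simp add: x_degree_le_def)
  with False show ?thesis by (intro exI[of _ "\<lambda>_ _. 0"]) auto
next
  case True
  then obtain n0 A0 where "n0 \<ge> 1" "A0 \<in> U \<inter> herm_tuples n0" by blast
  then have "x_power_series d S"
    using assms(6) by (auto simp: x_real_entire_at_def)
  then have hom: "x_homogeneous p (S p i j)" if "i < d" "j < d" for p i j
    using that by (simp add: x_power_series_def)
  \<comment> \<open>\<open>S\<close> is the same at every A and in every size, so a single
    polynomial serves all of U.\<close>
  let ?P = "\<lambda>i j. S 0 i j + S 1 i j + S 2 i j"
  have "x_degree_le 2 (?P i j)" if "i < d" "j < d" for i j
    using hom[OF that, of 0] hom[OF that, of 1] hom[OF that, of 2]
    by (intro x_degree_le_add) (auto simp: x_degree_le_def x_homogeneous_def)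
  moreover have "F i j (case_sum A X) = eval_ncpoly n (?P i j) (case_sum A X)"
    if n: "n \<ge> 1" and A: "A \<in> U \<inter> herm_tuples n" and X: "X \<in> herm_tuples n" and ij: "i < d" "j < d" for n A X i j
  proof (rule eq_matI)
    have "case_sum A X \<in> herm_tuples n"
      using A X by (auto simp: herm_tuples_def split: sum.splits)
    then have "F i j (case_sum A X) \<in> carrier_mat n n"
      using assms(4)[OF ij] n unfolding nc_function_def all_herm_tuples_def by blast
    then show "dim_row (F i j (case_sum A X)) = dim_row (eval_ncpoly n (?P i j) (case_sum A X))"
      "dim_col (F i j (case_sum A X)) = dim_col (eval_ncpoly n (?P i j) (case_sum A X))"
      by (simp_all add: eval_ncpoly_def)
    fix r s
    assume "r < dim_row (eval_ncpoly n (?P i j) (case_sum A X))" "s < dim_col (eval_ncpoly n (?P i j) (case_sum A X))"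
    then have rs: "r < n" "s < n" by (simp_all add: eval_ncpoly_def)
    have "A \<in> tuples n" using A herm_tuples_subset_tuples by blast
    from eq_quadratic_part[OF n this X _ _ ij rs]
    have "F i j (case_sum A X) $$ (r, s) = (\<Sum>p<3. eval_ncpoly n (S p i j) (case_sum A X) $$ (r, s))"
      using assms(6)[OF n A] by blast
    then show "F i j (case_sum A X) $$ (r, s) = eval_ncpoly n (?P i j) (case_sum A X) $$ (r, s)"
      using rs by (simp add: eval_ncpoly_add eval_nat_numeral)
  qed
  ultimately show ?thesis by (intro exI[of _ ?P]) blast
qed

end
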